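(* Let $P=\langle S,A,R\rangle$ be a functional Pure Type System such that $\lambda\Pi_P$ is terminating (every well-typed term of $\lambda\Pi_P$ is strongly normalizing for $\longrightarrow$). Let $A$ be a term of $P$ for which $\|A\|$ is defined. Then the type $\|A\|$ is inhabited by a closed term in $\lambda\Pi_P$ (i.e. there is $t$ with $\Sigma_P\vdash t:\|A\|$) if and only if the type $A$ is inhabited by a closed term in $P$ (i.e. there is $u$ with $[\,]\vdash u:A$ in $P$).
   Context: A Pure Type System $P=\langle S,A,R\rangle$ consists of a set $S$ of sorts, axioms $A\subseteq S\times S$ and rules $R\subseteq S\times S\times S$; its terms are $t::=x\mid s\mid \Pi x:t~t\mid \lambda x:t~t\mid t~t$ ($s\in S$), with the usual PTS typing rules (empty context, declaration $\Gamma[x:A]$ when $\Gamma\vdash A:s$, sort $\Gamma\vdash s_1:s_2$ for $\langle s_1,s_2\rangle\in A$, variable, product $\Gamma\vdash \Pi x:A~B:s_3$ from $\Gamma\vdash A:s_1$, $\Gamma[x:A]\vdash B:s_2$ with $\langle s_1,s_2,s_3\rangle\in R$, abstraction, application $\Gamma\vdash (t~u):(u/x)B$, and conversion modulo $\beta$-equivalence between types of the same sort). $P$ is functional if $\langle s_1,s_2\rangle,\langle s_1,s_3\rangle\in A$ implies $s_2=s_3$ and $\langle s_1,s_2,s_3\rangle,\langle s_1,s_2,s_4\rangle\in R$ implies $s_3=s_4$. The $\lambda\Pi$-calculus modulo: terms $t::=x\mid Type\mid Kind\mid \Pi x:t~t\mid\lambda x:t~t\mid t~t$, with the typing rules of the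 $\lambda\Pi$-calculus (axiom $Type:Kind$, products $\langle Type,Type,Type\rangle$ and $\langle Type,Kind,Kind\rangle$, corresponding abstractions, application, and declarations of variables whose type has type $Type$ or $Kind$), where the conversion rules use the congruence generated by $\beta$ and a given set of rewrite rules. Embedding of $P$: the context $\Sigma_P$ declares, for each sort $s$, $U_s:Type$ and $\varepsilon_s:U_s\Rightarrow Type$; for each axiom $\langle s_1,s_2\rangle$, $\dot{s_1}:U_{s_2}$; for each rule $\langle s_1,s_2,s_3\rangle$, $\dot\Pi_{\langle s_1,s_2,s_3\rangle}:\Pi X:U_{s_1}~(((\varepsilon_{s_1}~X)\Rightarrow U_{s_2})\Rightarrow U_{s_3})$. The rewrite rules are $\varepsilon_{s_2}~\dot{s_1}\longrightarrow U_{s_1}$ for each axiom and $\varepsilon_{s_3}(\dot\Pi_{\langle s_1,s_2,s_3\rangle}~X~Y)\longrightarrow \Pi x:(\varepsilon_{s_1}~X)~(\varepsilon_{s_2}~(Y~x))$ for each rule. $\lambda\Pi_P$ is the $\lambda\Pi$-calculus modulo these rules and $\beta$; $\equiv$ denotes the generated congruence, $\longrightarrow$ one-step $\beta$-or-rewrite reduction, and a judgement $\Gamma\vdash t:T$ in $\lambda\Pi_P$ means $\Sigma_P\Gamma\vdash t:T$. Translation of a term $t$ well-typed in a context $\Gamma$ of $P$: $|x|=x$; $|s|=\dot s$; $|\Pi x:A~B|=\dot\Pi_{\langle s_1,s_2,s_3\rangle}~|A|~(\lambda x:(\varepsilon_{s_1}~|A|)~|B|)$ where $s_1,s_2,s_3$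 are the types of $A$, $B$, $\Pi x:A~B$; $|\lambda x:A~t|=\lambda x:(\varepsilon_s~|A|)~|t|$ where $s$ is the type of $A$; $|t~u|=|t|~|u|$. For $A$ of type a sort $s$, $\|A\|=\varepsilon_s~|A|$; for a sort $s'$ that is not typable, $\|s'\|=U_{s'}$. Contexts: $\|[\,]\|=[\,]$, $\|\Gamma[x:A]\|=\|\Gamma\|[x:\|A\|]$. *)

theory Defs
  imports Main
begin

section \<open>Terms\<close>

text \<open>
  Terms in de Bruijn notation: \<open>Var i\<close> refers to the \<open>i\<close>-th enclosing binder, and the bodies of
  \<open>Pi A B\<close> and \<open>Lam A t\<close> have one more free index. The terms of a Pure Type System are those whose
  atoms are its sorts; the terms of the \<open>\<lambda>\<Pi>\<close>-calculus modulo are those whose atoms are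
  \<open>Type\<close>, \<open>Kind\<close> and the names declared in a global context.
\<close>

datatype 'a trm =
    Var nat
  | Atom 'a
  | Pi "'a trm" "'a trm"
  | Lam "'a trm" "'a trm"
  | App "'a trm" "'a trm"

definition up_ren :: "(nat \<Rightarrow> nat) \<Rightarrow> nat \<Rightarrow> nat" where
  "up_ren f i = (case i of 0 \<Rightarrow> 0 | Suc j \<Rightarrow> Suc (f j))"

primrec ren :: "(nat \<Rightarrow> nat) \<Rightarrow> 'a trm \<Rightarrow> 'a trm" where
  "ren f (Var i) = Var (f i)"
| "ren f (Atom a) = Atom a"
| "ren f (Pi A B) = Pi (ren f A) (ren (up_ren f) B)"
| "ren f (Lam A t) = Lam (ren f A) (ren (up_ren f) t)"
| "ren f (App t u) = App (ren f t) (ren f u)"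

definition lift :: "nat \<Rightarrow> 'a trm \<Rightarrow> 'a trm" where
  "lift n = ren (\<lambda>i. i + n)"

definition up_subst :: "(nat \<Rightarrow> 'a trm) \<Rightarrow> nat \<Rightarrow> 'a trm" where
  "up_subst \<sigma> i = (case i of 0 \<Rightarrow> Var 0 | Suc j \<Rightarrow> lift 1 (\<sigma> j))"

primrec subst :: "(nat \<Rightarrow> 'a trm) \<Rightarrow> 'a trm \<Rightarrow> 'a trm" where
  "subst \<sigma> (Var i) = \<sigma> i"
| "subst \<sigma> (Atom a) = Atom a"
| "subst \<sigma> (Pi A B) = Pi (subst \<sigma> A) (subst (up_subst \<sigma>) B)"
| "subst \<sigma> (Lam A t) = Lam (subst \<sigma> A) (subst (up_subst \<sigma>) t)"
| "subst \<sigma> (App t u) = App (subst \<sigma> t) (subst \<sigma> u)"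

definition inst :: "'a trm \<Rightarrow> 'a trm \<Rightarrow> 'a trm" where
  "inst u t = subst (\<lambda>i. case i of 0 \<Rightarrow> u | Suc j \<Rightarrow> Var j) t"

definition arrow :: "'a trm \<Rightarrow> 'a trm \<Rightarrow> 'a trm" where
  "arrow A B = Pi A (lift 1 B)"


section \<open>Reduction and conversion\<close>

text \<open>
  \<open>red R\<close> is one-step reduction by \<open>\<beta>\<close> and the rewrite rules in \<open>R\<close>, anywhere in a term. In a rule
  \<open>(l, r)\<close> the free indices are the pattern variables, and a simultaneous substitution
  instantiates them. Plain \<open>\<beta>\<close>-reduction is \<open>red {}\<close>.
\<close>

inductive red :: "('a trm \<times> 'a trm) set \<Rightarrow> 'a trm \<Rightarrow> 'a trm \<Rightarrow> bool"
  for R :: "('a trm \<times> 'a trm) set" where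
  beta: "red R (App (Lam A t) u) (inst u t)"
| rewrite: "(l, r) \<in> R \<Longrightarrow> red R (subst \<sigma> l) (subst \<sigma> r)"
| Pi_left: "red R A A' \<Longrightarrow> red R (Pi A B) (Pi A' B)"
| Pi_right: "red R B B' \<Longrightarrow> red R (Pi A B) (Pi A B')"
| Lam_left: "red R A A' \<Longrightarrow> red R (Lam A t) (Lam A' t)"
| Lam_right: "red R t t' \<Longrightarrow> red R (Lam A t) (Lam A t')"
| App_left: "red R t t' \<Longrightarrow> red R (App t u) (App t' u)"
| App_right: "red R u u' \<Longrightarrow> red R (App t u) (App t u')"

definition conv :: "('a trm \<times> 'a trm) set \<Rightarrow> 'a trm \<Rightarrow> 'a trm \<Rightarrow> bool" where
  "conv R = equivclp (red R)"

definition strongly_normalizing :: "('a trm \<times> 'a trm) set \<Rightarrow> 'a trm \<Rightarrow> bool" where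
  "strongly_normalizing R t \<longleftrightarrow> Wellfounded.termip (red R) t"


section \<open>Pure Type Systems\<close>

record 's pts =
  srts :: "'s set"
  axms :: "('s \<times> 's) set"
  ruls :: "('s \<times> 's \<times> 's) set"

definition is_pts :: "'s pts \<Rightarrow> bool" where
  "is_pts P \<longleftrightarrow> axms P \<subseteq> srts P \<times> srts P \<and> ruls P \<subseteq> srts P \<times> srts P \<times> srts P"

definition functional :: "'s pts \<Rightarrow> bool" where
  "functional P \<longleftrightarrow>
     (\<forall>s1 s2 s3. (s1, s2) \<in> axms P \<and> (s1, s3) \<in> axms P \<longrightarrow> s2 = s3) \<and>
     (\<forall>s1 s2 s3 s4. (s1, s2, s3) \<in> ruls P \<and> (s1, s2, s4) \<in> ruls P \<longrightarrow> s3 = s4)"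

text \<open>
  Contexts are lists with the most recent declaration first; the type at position \<open>i\<close> lives in the
  context \<open>drop (Suc i) \<Gamma>\<close>, hence the lifting in the variable rule. No separate condition that the
  sorts in a term belong to \<open>srts P\<close> is needed, as well-typed terms satisfy it.
\<close>

inductive pts_wf :: "'s pts \<Rightarrow> 's trm list \<Rightarrow> bool"
  and pts_typ :: "'s pts \<Rightarrow> 's trm list \<Rightarrow> 's trm \<Rightarrow> 's trm \<Rightarrow> bool"
  for P :: "'s pts" where
  pts_empty: "pts_wf P []"
| pts_decl: "pts_typ P \<Gamma> A (Atom s) \<Longrightarrow> pts_wf P (A # \<Gamma>)"
| pts_sort: "pts_wf P \<Gamma> \<Longrightarrow> (s1, s2) \<in> axms P \<Longrightarrow> pts_typ P \<Gamma> (Atom s1) (Atom s2)"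
| pts_var: "pts_wf P \<Gamma> \<Longrightarrow> i < length \<Gamma> \<Longrightarrow> pts_typ P \<Gamma> (Var i) (lift (Suc i) (\<Gamma> ! i))"
| pts_prod: "pts_typ P \<Gamma> A (Atom s1) \<Longrightarrow> pts_typ P (A # \<Gamma>) B (Atom s2) \<Longrightarrow>
    (s1, s2, s3) \<in> ruls P \<Longrightarrow> pts_typ P \<Gamma> (Pi A B) (Atom s3)"
| pts_abs: "pts_typ P \<Gamma> A (Atom s1) \<Longrightarrow> pts_typ P (A # \<Gamma>) B (Atom s2) \<Longrightarrow>
    pts_typ P (A # \<Gamma>) t B \<Longrightarrow> (s1, s2, s3) \<in> ruls P \<Longrightarrow> pts_typ P \<Gamma> (Lam A t) (Pi A B)"
| pts_app: "pts_typ P \<Gamma> t (Pi A B) \<Longrightarrow> pts_typ P \<Gamma> u A \<Longrightarrow> pts_typ P \<Gamma> (App t u) (inst u B)"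
| pts_conv: "pts_typ P \<Gamma> A (Atom s) \<Longrightarrow> pts_typ P \<Gamma> B (Atom s) \<Longrightarrow> pts_typ P \<Gamma> t A \<Longrightarrow>
    conv {} A B \<Longrightarrow> pts_typ P \<Gamma> t B"


section \<open>The \<open>\<lambda>\<Pi>\<close>-calculus modulo\<close>

datatype 'c lp_atom = Type | Kind | Cst 'c

text \<open>
  \<open>lp_typ \<Sigma> R \<Gamma> t T\<close> is the judgement \<open>\<Sigma>\<Gamma> \<turnstile> t : T\<close> modulo \<open>R\<close>. The global context \<open>\<Sigma>\<close> is kept apart
  from the local one because it may be infinite; its variables are the atoms \<open>Cst c\<close>. The
  well-formedness of \<open>\<Sigma>\<close> is checked when a variable declared in it is used: its type must itself be
  typable by \<open>Type\<close> or \<open>Kind\<close> (in the empty local context, so that it is closed), and derivations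
  being finite, such dependencies cannot be circular.
\<close>

inductive lp_wf :: "('c \<times> 'c lp_atom trm) set \<Rightarrow> ('c lp_atom trm \<times> 'c lp_atom trm) set \<Rightarrow>
    'c lp_atom trm list \<Rightarrow> bool"
  and lp_typ :: "('c \<times> 'c lp_atom trm) set \<Rightarrow> ('c lp_atom trm \<times> 'c lp_atom trm) set \<Rightarrow>
    'c lp_atom trm list \<Rightarrow> 'c lp_atom trm \<Rightarrow> 'c lp_atom trm \<Rightarrow> bool"
  for \<Sigma> :: "('c \<times> 'c lp_atom trm) set" and R :: "('c lp_atom trm \<times> 'c lp_atom trm) set" where
  lp_empty: "lp_wf \<Sigma> R []"
| lp_decl: "lp_typ \<Sigma> R \<Gamma> A (Atom k) \<Longrightarrow> k \<in> {Type, Kind} \<Longrightarrow> lp_wf \<Sigma> R (A # \<Gamma>)"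
| lp_sort: "lp_wf \<Sigma> R \<Gamma> \<Longrightarrow> lp_typ \<Sigma> R \<Gamma> (Atom Type) (Atom Kind)"
| lp_const: "lp_wf \<Sigma> R \<Gamma> \<Longrightarrow> (c, A) \<in> \<Sigma> \<Longrightarrow> lp_typ \<Sigma> R [] A (Atom k) \<Longrightarrow> k \<in> {Type, Kind} \<Longrightarrow>
    lp_typ \<Sigma> R \<Gamma> (Atom (Cst c)) A"
| lp_var: "lp_wf \<Sigma> R \<Gamma> \<Longrightarrow> i < length \<Gamma> \<Longrightarrow> lp_typ \<Sigma> R \<Gamma> (Var i) (lift (Suc i) (\<Gamma> ! i))"
| lp_prod: "lp_typ \<Sigma> R \<Gamma> A (Atom Type) \<Longrightarrow> lp_typ \<Sigma> R (A # \<Gamma>) B (Atom k) \<Longrightarrow>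
    k \<in> {Type, Kind} \<Longrightarrow> lp_typ \<Sigma> R \<Gamma> (Pi A B) (Atom k)"
| lp_abs: "lp_typ \<Sigma> R \<Gamma> A (Atom Type) \<Longrightarrow> lp_typ \<Sigma> R (A # \<Gamma>) B (Atom k) \<Longrightarrow>
    lp_typ \<Sigma> R (A # \<Gamma>) t B \<Longrightarrow> k \<in> {Type, Kind} \<Longrightarrow> lp_typ \<Sigma> R \<Gamma> (Lam A t) (Pi A B)"
| lp_app: "lp_typ \<Sigma> R \<Gamma> t (Pi A B) \<Longrightarrow> lp_typ \<Sigma> R \<Gamma> u A \<Longrightarrow> lp_typ \<Sigma> R \<Gamma> (App t u) (inst u B)"
| lp_conv: "lp_typ \<Sigma> R \<Gamma> A (Atom k) \<Longrightarrow> lp_typ \<Sigma> R \<Gamma> B (Atom k) \<Longrightarrow> k \<in> {Type, Kind} \<Longrightarrow>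
    lp_typ \<Sigma> R \<Gamma> t A \<Longrightarrow> conv R A B \<Longrightarrow> lp_typ \<Sigma> R \<Gamma> t B"

definition lp_terminating ::
    "('c \<times> 'c lp_atom trm) set \<Rightarrow> ('c lp_atom trm \<times> 'c lp_atom trm) set \<Rightarrow> bool" where
  "lp_terminating \<Sigma> R \<longleftrightarrow> (\<forall>\<Gamma> t T. lp_typ \<Sigma> R \<Gamma> t T \<longrightarrow> strongly_normalizing R t)"


section \<open>The embedding\<close>

datatype 's emb_const = CU 's | CEpsilon 's | CDot 's | CDotPi 's 's 's

type_synonym 's emb_trm = "'s emb_const lp_atom trm"

abbreviation U :: "'s \<Rightarrow> 's emb_trm" where
  "U s \<equiv> Atom (Cst (CU s))"

abbreviation Epsilon :: "'s \<Rightarrow> 's emb_trm \<Rightarrow> 's emb_trm" where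
  "Epsilon s t \<equiv> App (Atom (Cst (CEpsilon s))) t"

abbreviation Dot :: "'s \<Rightarrow> 's emb_trm" where
  "Dot s \<equiv> Atom (Cst (CDot s))"

abbreviation DotPi :: "'s \<Rightarrow> 's \<Rightarrow> 's \<Rightarrow> 's emb_trm \<Rightarrow> 's emb_trm \<Rightarrow> 's emb_trm" where
  "DotPi s1 s2 s3 X Y \<equiv> App (App (Atom (Cst (CDotPi s1 s2 s3))) X) Y"

definition emb_sig :: "'s pts \<Rightarrow> ('s emb_const \<times> 's emb_trm) set" where
  "emb_sig P =
     {(CU s, Atom Type) | s. s \<in> srts P} \<union>
     {(CEpsilon s, arrow (U s) (Atom Type)) | s. s \<in> srts P} \<union>
     {(CDot s1, U s2) | s1 s2. (s1, s2) \<in> axms P} \<union>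
     {(CDotPi s1 s2 s3, Pi (U s1) (arrow (arrow (Epsilon s1 (Var 0)) (U s2)) (U s3))) | s1 s2 s3.
        (s1, s2, s3) \<in> ruls P}"

text \<open>
  In the second family of rules the pattern variables are \<open>X = Var 1\<close> and \<open>Y = Var 0\<close>, which become
  \<open>Var 2\<close> and \<open>Var 1\<close> under the binder of the right-hand side.
\<close>

definition emb_rew :: "'s pts \<Rightarrow> ('s emb_trm \<times> 's emb_trm) set" where
  "emb_rew P =
     {(Epsilon s2 (Dot s1), U s1) | s1 s2. (s1, s2) \<in> axms P} \<union>
     {(Epsilon s3 (DotPi s1 s2 s3 (Var 1) (Var 0)),
       Pi (Epsilon s1 (Var 1)) (Epsilon s2 (App (Var 1) (Var 0)))) | s1 s2 s3. (s1, s2, s3) \<in> ruls P}"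

abbreviation emb_typ :: "'s pts \<Rightarrow> 's emb_trm list \<Rightarrow> 's emb_trm \<Rightarrow> 's emb_trm \<Rightarrow> bool" where
  "emb_typ P \<equiv> lp_typ (emb_sig P) (emb_rew P)"

text \<open>
  In a functional Pure Type System a term has at most one sort as a type, so that the descriptions
  below are meaningful on well-typed terms.
\<close>

definition sort_of :: "'s pts \<Rightarrow> 's trm list \<Rightarrow> 's trm \<Rightarrow> 's" where
  "sort_of P \<Gamma> A = (THE s. pts_typ P \<Gamma> A (Atom s))"

primrec transl :: "'s pts \<Rightarrow> 's trm list \<Rightarrow> 's trm \<Rightarrow> 's emb_trm" where
  "transl P \<Gamma> (Var i) = Var i"
| "transl P \<Gamma> (Atom s) = Dot s"
| "transl P \<Gamma> (Pi A B) =
     DotPi (sort_of P \<Gamma> A) (sort_of P (A # \<Gamma>) B) (sort_of P \<Gamma> (Pi A B))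
       (transl P \<Gamma> A)
       (Lam (Epsilon (sort_of P \<Gamma> A) (transl P \<Gamma> A)) (transl P (A # \<Gamma>) B))"
| "transl P \<Gamma> (Lam A t) =
     Lam (Epsilon (sort_of P \<Gamma> A) (transl P \<Gamma> A)) (transl P (A # \<Gamma>) t)"
| "transl P \<Gamma> (App t u) = App (transl P \<Gamma> t) (transl P \<Gamma> u)"

text \<open>The translation of a term as a type, \<open>None\<close> where it is undefined.\<close>

definition transl_type :: "'s pts \<Rightarrow> 's trm list \<Rightarrow> 's trm \<Rightarrow> 's emb_trm option" where
  "transl_type P \<Gamma> A =
     (if \<exists>s. pts_typ P \<Gamma> A (Atom s) then Some (Epsilon (sort_of P \<Gamma> A) (transl P \<Gamma> A))
      else case A of
          Atom s' \<Rightarrow> if s' \<in> srts P \<and> \<not> (\<exists>T. pts_typ P \<Gamma> A T) then Some (U s') else None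
        | _ \<Rightarrow> None)"

end

theory Submission
  imports Defs "HOL-Library.Confluence"
begin

text \<open>
  From right to left, the translation of a term typed in \<open>P\<close> is typed in the \<open>\<lambda>\<Pi>\<close>-calculus modulo,
  by induction on the derivation: substitution and \<open>\<beta>\<close>-reduction commute with the translation, because
  the sort of a term is unique and invariant under both.

  From left to right, let \<open>t\<close> have type \<open>\<parallel>A\<parallel>\<close>. First replace every constant \<open>\<Pi>\<close> with a dot by an
  expansion of it that has the same type; this preserves typing, and afterwards such a constant only
  occurs applied to some \<open>X\<close> and some \<open>\<lambda>x. Y\<close>, which reduction preserves. Termination and subject
  reduction then yield a normal form of type \<open>\<parallel>A\<parallel>\<close>. By induction on the size of such normal terms, in
  arbitrary translated contexts, they are convertible to translations of terms of type \<open>A\<close>.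
  Conversions of types are carried back to \<open>P\<close> by an untyped inverse of the translation, which maps
  \<open>U\<close> and the dotted sorts to sorts, \<open>\<epsilon>\<close> to the identity and the dotted \<open>\<Pi>\<close> to
  \<open>\<lambda>X Y. \<Pi>x:X. Y x\<close>; it preserves conversion, so no termination argument is needed in \<open>P\<close>.
\<close>

section \<open>Substitution\<close>

text \<open>The product constants are expanded because conversion lacks \<eta>. A partially applied
  constant, or one whose second argument is a variable \<open>Y\<close>, can be a normal inhabitant
  of a translated type. But a product of \<open>P\<close> translates to a constant applied to an
  abstraction, and \<lambda>x. Y x is not \<beta>-convertible to \<open>Y\<close>.

  The types inside a derivation need not be translations. For a normal term that is not an
  abstraction they are recovered along the spine of applications: apart from a few terms outside the
  image, excluded by their types, the head is a variable, a dotted sort or a saturated dotted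
  product, whose type is a translation up to conversion, and this fixes the domain against which the
  next argument is checked. Abstractions take their type from outside.

  When a type of \<open>P\<close> has to be exposed as a product, confluence of \<beta> does it: its
  image under the inverse translation is already convertible to a product.\<close>

lemma up_ren_simps [simp]: "up_ren f 0 = 0" "up_ren f (Suc i) = Suc (f i)"
  by (simp_all add: up_ren_def)

lemma up_subst_simps [simp]:
  "up_subst \<sigma> 0 = Var 0" "up_subst \<sigma> (Suc i) = ren Suc (\<sigma> i)"
  by (simp_all add: up_subst_def lift_def)

lemma up_ren_comp: "up_ren f \<circ> up_ren g = up_ren (f \<circ> g)"
  by (rule ext) (simp add: up_ren_def split: nat.split)

lemma ren_ren: "ren f (ren g t) = ren (f \<circ> g) t"
  by (induction t arbitrary: f g) (simp_all add: up_ren_comp)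

lemma up_subst_up_ren: "up_subst \<sigma> \<circ> up_ren f = up_subst (\<sigma> \<circ> f)"
  by (rule ext) (simp add: up_ren_def up_subst_def split: nat.split)

lemma subst_ren: "subst \<sigma> (ren f t) = subst (\<sigma> \<circ> f) t"
  by (induction t arbitrary: f \<sigma>) (simp_all add: up_subst_up_ren)

lemma ren_up_subst: "ren (up_ren f) \<circ> up_subst \<sigma> = up_subst (ren f \<circ> \<sigma>)"
  by (rule ext) (simp add: up_subst_def lift_def ren_ren o_def split: nat.split)

lemma ren_subst: "ren f (subst \<sigma> t) = subst (ren f \<circ> \<sigma>) t"
  by (induction t arbitrary: f \<sigma>) (simp_all add: ren_up_subst)

lemma subst_up_subst: "subst (up_subst \<tau>) \<circ> up_subst \<sigma> = up_subst (subst \<tau> \<circ> \<sigma>)"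
proof
  fix i show "(subst (up_subst \<tau>) \<circ> up_subst \<sigma>) i = up_subst (subst \<tau> \<circ> \<sigma>) i"
    by (cases i) (simp_all add: subst_ren ren_subst o_def)
qed

lemma subst_subst: "subst \<tau> (subst \<sigma> t) = subst (subst \<tau> \<circ> \<sigma>) t"
  by (induction t arbitrary: \<tau> \<sigma>) (simp_all add: subst_up_subst)

lemma up_subst_Var [simp]: "up_subst Var = Var"
  by (rule ext) (simp add: up_subst_def lift_def split: nat.split)

lemma subst_Var [simp]: "subst Var t = t"
  by (induction t) simp_all

lemma ren_as_subst: "ren f t = subst (Var \<circ> f) t"
  using subst_ren[of Var f t] by simp

lemma inst_eq: "inst u t = subst (case_nat u Var) t"
  by (simp add: inst_def)

lemma subst_inst: "subst \<sigma> (inst u t) = inst (subst \<sigma> u) (subst (up_subst \<sigma>) t)"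
proof -
  have "subst \<sigma> \<circ> case_nat u Var = subst (case_nat (subst \<sigma> u) Var) \<circ> up_subst \<sigma>"
    by (rule ext) (simp add: up_subst_def lift_def subst_ren o_def split: nat.split)
  then show ?thesis by (simp add: inst_eq subst_subst)
qed

lemma ren_inst: "ren f (inst u t) = inst (ren f u) (ren (up_ren f) t)"
proof -
  have "ren f \<circ> case_nat u Var = case_nat (ren f u) Var \<circ> up_ren f"
    by (rule ext) (simp add: up_ren_def split: nat.split)
  then show ?thesis by (simp add: inst_eq ren_subst subst_ren)
qed

lemma inst_lift [simp]: "inst u (ren Suc t) = t"
  by (simp add: inst_eq subst_ren o_def)

lemma ren_up_Suc: "ren (up_ren f) (ren Suc t) = ren Suc (ren f t)"
  by (simp add: ren_ren o_def)

lemma subst_up_Suc: "subst (up_subst \<sigma>) (ren Suc t) = ren Suc (subst \<sigma> t)"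
  by (simp add: subst_ren ren_subst o_def)

lemma inst_Var_up_ren: "inst (Var 0) (ren (up_ren Suc) t) = t"
proof -
  have "case_nat (Var 0) Var \<circ> up_ren Suc = (Var :: nat \<Rightarrow> 'a trm)"
    by (rule ext) (simp add: up_ren_def split: nat.split)
  then show ?thesis by (simp add: inst_eq subst_ren)
qed

lemma closed_ren: "(\<And>\<sigma>. subst \<sigma> t = t) \<Longrightarrow> ren f t = t"
  by (simp add: ren_as_subst)

section \<open>Conversion\<close>

lemma conv_refl [simp, intro]: "conv R t t"
  by (simp add: conv_def)

lemma conv_sym: "conv R t u \<Longrightarrow> conv R u t"
  by (simp add: conv_def equivclp_sym)

lemma conv_trans [trans]: "conv R t u \<Longrightarrow> conv R u v \<Longrightarrow> conv R t v"
  unfolding conv_def by (rule equivclp_trans)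

lemma red_conv: "red R t u \<Longrightarrow> conv R t u"
  by (auto simp: conv_def)

lemma reds_conv: "(red R)\<^sup>*\<^sup>* t u \<Longrightarrow> conv R t u"
  by (simp add: conv_def rtranclp_into_equivclp)

lemma conv_induct [consumes 1, case_names refl step_conv]:
  assumes "conv R t u" "\<And>t. Q t t"
    and "\<And>t u v. Q t u \<Longrightarrow> red R u v \<or> red R v u \<Longrightarrow> Q t v"
  shows "Q t u"
  using assms(1) unfolding conv_def
  by (induction rule: equivclp_induct) (use assms in blast)+

lemma conv_map:
  assumes "conv R t u" "\<And>t u. red R t u \<Longrightarrow> conv R' (f t) (f u)"
  shows "conv R' (f t) (f u)"
  using assms(1)
  by (induction rule: conv_induct) (blast intro: conv_trans assms(2) conv_sym conv_refl)+

lemma conv_Pi: "conv R A A' \<Longrightarrow> conv R B B' \<Longrightarrow> conv R (Pi A B) (Pi A' B')"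
  using conv_map[of R A A' R "\<lambda>A. Pi A B"] conv_map[of R B B' R "\<lambda>B. Pi A' B"]
  by (meson conv_trans red_conv red.Pi_left red.Pi_right)

lemma conv_Lam: "conv R A A' \<Longrightarrow> conv R B B' \<Longrightarrow> conv R (Lam A B) (Lam A' B')"
  using conv_map[of R A A' R "\<lambda>A. Lam A B"] conv_map[of R B B' R "\<lambda>B. Lam A' B"]
  by (meson conv_trans red_conv red.Lam_left red.Lam_right)

lemma conv_App: "conv R A A' \<Longrightarrow> conv R B B' \<Longrightarrow> conv R (App A B) (App A' B')"
  using conv_map[of R A A' R "\<lambda>A. App A B"] conv_map[of R B B' R "\<lambda>B. App A' B"]
  by (meson conv_trans red_conv red.App_left red.App_right)

lemma red_subst: "red R t u \<Longrightarrow> red R (subst \<sigma> t) (subst \<sigma> u)"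
proof (induction arbitrary: \<sigma> rule: red.induct)
  case (beta A t u)
  show ?case by (simp add: subst_inst red.beta)
next
  case (rewrite l r \<tau>)
  then show ?case by (simp add: subst_subst red.rewrite)
qed (auto intro: red.intros)

lemma conv_subst: "conv R t u \<Longrightarrow> conv R (subst \<sigma> t) (subst \<sigma> u)"
  by (erule conv_map) (blast intro: red_conv red_subst)

lemma conv_ren: "conv R t u \<Longrightarrow> conv R (ren f t) (ren f u)"
  by (simp add: ren_as_subst conv_subst)

lemma conv_subst_conv: "(\<And>i. conv R (\<sigma> i) (\<tau> i)) \<Longrightarrow> conv R (subst \<sigma> t) (subst \<tau> t)"
proof (induction t arbitrary: \<sigma> \<tau>)
  case (Pi A B)
  have "conv R (up_subst \<sigma> i) (up_subst \<tau> i)" for i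
    by (cases i) (simp_all add: conv_ren Pi)
  then show ?case using Pi by (simp add: conv_Pi)
next
  case (Lam A B)
  have "conv R (up_subst \<sigma> i) (up_subst \<tau> i)" for i
    by (cases i) (simp_all add: conv_ren Lam)
  then show ?case using Lam by (simp add: conv_Lam)
qed (simp_all add: conv_App)

lemma conv_inst: "conv R u u' \<Longrightarrow> conv R t t' \<Longrightarrow> conv R (inst u t) (inst u' t')"
proof -
  assume u: "conv R u u'" and t: "conv R t t'"
  have "conv R (subst (case_nat u Var) t) (subst (case_nat u' Var) t)"
    by (rule conv_subst_conv) (simp add: u split: nat.split)
  then show ?thesis unfolding inst_eq by (blast intro: conv_trans conv_subst t)
qed

lemma conv_beta: "conv R (App (Lam A t) u) (inst u t)"
  by (rule red_conv) (rule red.beta)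

subsection \<open>Replacing atoms by closed terms\<close>

text \<open>No lifting takes place under binders: the lemmas below assume every \<open>h a\<close>
  to be closed. The inverse translation and the expansion of product constants are both of this
  form.\<close>

primrec asub :: "('a \<Rightarrow> 'b trm) \<Rightarrow> 'a trm \<Rightarrow> 'b trm" where
  "asub h (Var i) = Var i"
| "asub h (Atom a) = h a"
| "asub h (Pi A B) = Pi (asub h A) (asub h B)"
| "asub h (Lam A t) = Lam (asub h A) (asub h t)"
| "asub h (App t u) = App (asub h t) (asub h u)"

context
  fixes h :: "'a \<Rightarrow> 'b trm"
  assumes closed: "\<And>a \<sigma>. subst \<sigma> (h a) = h a"
begin

lemma asub_ren: "asub h (ren f t) = ren f (asub h t)"
  by (induction t arbitrary: f) (simp_all add: closed_ren closed)

lemma asub_subst: "asub h (subst \<sigma> t) = subst (asub h \<circ> \<sigma>) (asub h t)"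
proof (induction t arbitrary: \<sigma>)
  have *: "asub h \<circ> up_subst \<sigma> = up_subst (asub h \<circ> \<sigma>)" for \<sigma>
    by (rule ext) (simp add: up_subst_def lift_def asub_ren split: nat.split)
  {
    case (Pi A B)
    then show ?case by (simp only: subst.simps asub.simps *)
  next
    case (Lam A t)
    then show ?case by (simp only: subst.simps asub.simps *)
  }
qed (simp_all add: closed)

lemma asub_inst: "asub h (inst u t) = inst (asub h u) (asub h t)"
proof -
  have "asub h \<circ> case_nat u Var = case_nat (asub h u) Var"
    by (rule ext) (simp split: nat.split)
  then show ?thesis by (simp add: inst_eq asub_subst)
qed

text \<open>An instance of a rule is mapped to an instance of the images of its two sides, so only
  the rules themselves have to be checked; \<beta> is preserved by any such replacement.\<close>

lemma asub_conv:
  assumes "conv R t u"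
    and rules: "\<And>l r \<sigma>. (l, r) \<in> R \<Longrightarrow> conv R' (subst \<sigma> (asub h l)) (subst \<sigma> (asub h r))"
  shows "conv R' (asub h t) (asub h u)"
  using assms(1)
proof (rule conv_map)
  fix t u assume "red R t u"
  then show "conv R' (asub h t) (asub h u)"
    by induction (simp_all add: asub_inst asub_subst conv_beta rules conv_Pi conv_Lam conv_App)
qed

end


subsection \<open>Confluence\<close>

text \<open>The two shapes of left-hand sides are those of the embedding. The set \<open>D\<close> of their head atoms
  must not contain \<open>d\<close> in the second one, where the two could otherwise overlap.\<close>

definition orthogonal :: "'a set \<Rightarrow> ('a trm \<times> 'a trm) set \<Rightarrow> bool" where
  "orthogonal D R \<longleftrightarrow>
     (\<forall>l r. (l, r) \<in> R \<longrightarrow>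
        (\<exists>e\<in>D. \<exists>d. l = App (Atom e) (Atom d) \<and> (\<forall>\<sigma>. subst \<sigma> r = r)) \<or>
        (\<exists>e\<in>D. \<exists>d. d \<notin> D \<and> l = App (Atom e) (App (App (Atom d) (Var 1)) (Var 0)) \<and>
           (\<forall>\<sigma> \<tau>. \<sigma> 0 = \<tau> 0 \<longrightarrow> \<sigma> 1 = \<tau> 1 \<longrightarrow> subst \<sigma> r = subst \<tau> r))) \<and>
     (\<forall>l r r'. (l, r) \<in> R \<longrightarrow> (l, r') \<in> R \<longrightarrow> r = r')"

lemma orthogonal_empty: "orthogonal {} {}"
  by (simp add: orthogonal_def)

text \<open>Parallel reduction in the style of Tait and Martin-Loef. A rewrite step also reduces
  inside the instances of the pattern variables. Requiring this at every index is no restriction, as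
  the two substitutions may agree elsewhere.\<close>

inductive par :: "('a trm \<times> 'a trm) set \<Rightarrow> 'a trm \<Rightarrow> 'a trm \<Rightarrow> bool"
  for R :: "('a trm \<times> 'a trm) set" where
  par_Var: "par R (Var i) (Var i)"
| par_Atom: "par R (Atom a) (Atom a)"
| par_Pi: "par R A A' \<Longrightarrow> par R B B' \<Longrightarrow> par R (Pi A B) (Pi A' B')"
| par_Lam: "par R A A' \<Longrightarrow> par R t t' \<Longrightarrow> par R (Lam A t) (Lam A' t')"
| par_App: "par R t t' \<Longrightarrow> par R u u' \<Longrightarrow> par R (App t u) (App t' u')"
| par_beta: "par R t t' \<Longrightarrow> par R u u' \<Longrightarrow> par R (App (Lam A t) u) (inst u' t')"
| par_rewrite: "(l, r) \<in> R \<Longrightarrow> (\<And>i. par R (\<sigma> i) (\<tau> i)) \<Longrightarrow> par R (subst \<sigma> l) (subst \<tau> r)"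

lemma par_refl [simp, intro]: "par R t t"
  by (induction t) (auto intro: par.intros)

lemma par_ren: "par R t u \<Longrightarrow> par R (ren f t) (ren f u)"
proof (induction arbitrary: f rule: par.induct)
  case (par_beta t t' u u' A)
  then show ?case by (simp add: ren_inst par.par_beta)
next
  case (par_rewrite l r \<sigma> \<tau>)
  then show ?case unfolding ren_subst by (intro par.par_rewrite) simp_all
qed (auto intro: par.intros)

lemma par_up: "(\<And>i. par R (\<sigma> i) (\<tau> i)) \<Longrightarrow> par R (up_subst \<sigma> i) (up_subst \<tau> i)"
  by (cases i) (simp_all add: par_ren)

lemma par_subst:
  "par R t u \<Longrightarrow> (\<And>i. par R (\<sigma> i) (\<tau> i)) \<Longrightarrow> par R (subst \<sigma> t) (subst \<tau> u)"
proof (induction arbitrary: \<sigma> \<tau> rule: par.induct)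
  case (par_beta t t' u u' A)
  then show ?case by (simp add: subst_inst par.par_beta par_up)
next
  case (par_rewrite l r \<sigma>' \<tau>')
  then show ?case unfolding subst_subst by (intro par.par_rewrite) simp_all
qed (simp_all add: par.intros par_up)

lemma par_inst: "par R t t' \<Longrightarrow> par R u u' \<Longrightarrow> par R (inst u t) (inst u' t')"
  unfolding inst_eq by (rule par_subst) (simp_all split: nat.split)

lemma red_par: "red R t u \<Longrightarrow> par R t u"
  by (induction rule: red.induct) (auto intro: par.intros)

section \<open>Many-step reduction as a congruence, and its agreement with parallel
  reduction\<close>

lemma reds_Pi: "(red R)\<^sup>*\<^sup>* A A' \<Longrightarrow> (red R)\<^sup>*\<^sup>* B B' \<Longrightarrow> (red R)\<^sup>*\<^sup>* (Pi A B) (Pi A' B')"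
proof -
  assume A: "(red R)\<^sup>*\<^sup>* A A'" and B: "(red R)\<^sup>*\<^sup>* B B'"
  from A have "(red R)\<^sup>*\<^sup>* (Pi A B) (Pi A' B)"
    by induction (auto intro: red.intros rtranclp.rtrancl_into_rtrancl)
  also from B have "(red R)\<^sup>*\<^sup>* (Pi A' B) (Pi A' B')"
    by induction (auto intro: red.intros rtranclp.rtrancl_into_rtrancl)
  finally show ?thesis .
qed

lemma reds_Lam: "(red R)\<^sup>*\<^sup>* A A' \<Longrightarrow> (red R)\<^sup>*\<^sup>* B B' \<Longrightarrow> (red R)\<^sup>*\<^sup>* (Lam A B) (Lam A' B')"
proof -
  assume A: "(red R)\<^sup>*\<^sup>* A A'" and B: "(red R)\<^sup>*\<^sup>* B B'"
  from A have "(red R)\<^sup>*\<^sup>* (Lam A B) (Lam A' B)"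
    by induction (auto intro: red.intros rtranclp.rtrancl_into_rtrancl)
  also from B have "(red R)\<^sup>*\<^sup>* (Lam A' B) (Lam A' B')"
    by induction (auto intro: red.intros rtranclp.rtrancl_into_rtrancl)
  finally show ?thesis .
qed

lemma reds_App: "(red R)\<^sup>*\<^sup>* A A' \<Longrightarrow> (red R)\<^sup>*\<^sup>* B B' \<Longrightarrow> (red R)\<^sup>*\<^sup>* (App A B) (App A' B')"
proof -
  assume A: "(red R)\<^sup>*\<^sup>* A A'" and B: "(red R)\<^sup>*\<^sup>* B B'"
  from A have "(red R)\<^sup>*\<^sup>* (App A B) (App A' B)"
    by induction (auto intro: red.intros rtranclp.rtrancl_into_rtrancl)
  also from B have "(red R)\<^sup>*\<^sup>* (App A' B) (App A' B')"
    by induction (auto intro: red.intros rtranclp.rtrancl_into_rtrancl)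
  finally show ?thesis .
qed

lemma reds_subst: "(red R)\<^sup>*\<^sup>* t u \<Longrightarrow> (red R)\<^sup>*\<^sup>* (subst \<sigma> t) (subst \<sigma> u)"
  by (induction rule: rtranclp_induct) (auto intro: red_subst rtranclp.rtrancl_into_rtrancl)

lemma reds_ren: "(red R)\<^sup>*\<^sup>* t u \<Longrightarrow> (red R)\<^sup>*\<^sup>* (ren f t) (ren f u)"
  by (simp add: ren_as_subst reds_subst)

lemma reds_subst_reds:
  "(\<And>i. (red R)\<^sup>*\<^sup>* (\<sigma> i) (\<tau> i)) \<Longrightarrow> (red R)\<^sup>*\<^sup>* (subst \<sigma> t) (subst \<tau> t)"
proof (induction t arbitrary: \<sigma> \<tau>)
  case (Pi A B)
  have "(red R)\<^sup>*\<^sup>* (up_subst \<sigma> i) (up_subst \<tau> i)" for i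
    by (cases i) (simp_all add: reds_ren Pi)
  then show ?case using Pi by (simp add: reds_Pi)
next
  case (Lam A B)
  have "(red R)\<^sup>*\<^sup>* (up_subst \<sigma> i) (up_subst \<tau> i)" for i
    by (cases i) (simp_all add: reds_ren Lam)
  then show ?case using Lam by (simp add: reds_Lam)
qed (simp_all add: reds_App)

lemma par_reds: "par R t u \<Longrightarrow> (red R)\<^sup>*\<^sup>* t u"
proof (induction rule: par.induct)
  case (par_beta t t' u u' A)
  then have "(red R)\<^sup>*\<^sup>* (App (Lam A t) u) (App (Lam A t') u')"
    by (intro reds_App reds_Lam) auto
  then show ?case by (rule rtranclp.rtrancl_into_rtrancl) (rule red.beta)
next
  case (par_rewrite l r \<sigma> \<tau>)
  then have "(red R)\<^sup>*\<^sup>* (subst \<sigma> l) (subst \<tau> l)" by (blast intro: reds_subst_reds)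
  then show ?case by (rule rtranclp.rtrancl_into_rtrancl) (rule red.rewrite[OF par_rewrite(1)])
qed (auto intro: reds_Pi reds_Lam reds_App)

inductive_cases par_AtomE: "par R (Atom a) u"
inductive_cases par_VarE: "par R (Var a) u"
inductive_cases par_PiE: "par R (Pi A B) u"
inductive_cases par_LamE: "par R (Lam A B) u"
inductive_cases par_AppE: "par R (App A B) u"

context
  fixes D :: "'a set" and R :: "('a trm \<times> 'a trm) set"
  assumes orth: "orthogonal D R"
begin

lemma lhs_cases:
  assumes "(l, r) \<in> R"
  obtains e d where "e \<in> D" "l = App (Atom e) (Atom d)" "\<And>\<sigma>. subst \<sigma> r = r"
  | e d where "e \<in> D" "d \<notin> D" "l = App (Atom e) (App (App (Atom d) (Var 1)) (Var 0))"
      "\<And>\<sigma> \<tau>. \<sigma> 0 = \<tau> 0 \<Longrightarrow> \<sigma> 1 = \<tau> 1 \<Longrightarrow> subst \<sigma> r = subst \<tau> r"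
  using orth assms unfolding orthogonal_def by metis

lemma rule_unique: "(l, r) \<in> R \<Longrightarrow> (l, r') \<in> R \<Longrightarrow> r = r'"
  using orth unfolding orthogonal_def by blast

lemma subst_lhs_cases:
  assumes "(l, r) \<in> R"
  obtains e d where "e \<in> D" "\<And>\<sigma>. subst \<sigma> l = App (Atom e) (Atom d)"
  | e d where "e \<in> D" "d \<notin> D" "\<And>\<sigma>. subst \<sigma> l = App (Atom e) (App (App (Atom d) (\<sigma> 1)) (\<sigma> 0))"
  using lhs_cases[OF assms] by (metis subst.simps)

lemma par_inv:
  "par R (Var i) u \<longleftrightarrow> u = Var i"
  "par R (Atom a) u \<longleftrightarrow> u = Atom a"
  "par R (Pi A B) u \<longleftrightarrow> (\<exists>A' B'. u = Pi A' B' \<and> par R A A' \<and> par R B B')"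
  "par R (Lam A B) u \<longleftrightarrow> (\<exists>A' B'. u = Lam A' B' \<and> par R A A' \<and> par R B B')"
     apply (auto intro: par.intros)
     apply (auto elim!: par_VarE par_AtomE par_PiE par_LamE)
  by (metis subst_lhs_cases trm.distinct)+

text \<open>In the last case the substitution is replaced by one built from the two pattern
  variables alone; the right-hand side depends on nothing else, by
  \<open>orthogonal\<close>.\<close>

lemma par_App_inv:
  assumes "par R (App t u) v"
  obtains t' u' where "v = App t' u'" "par R t t'" "par R u u'"
  | A b b' u' where "t = Lam A b" "v = inst u' b'" "par R b b'" "par R u u'"
  | e d r where "(App (Atom e) (Atom d), r) \<in> R" "t = Atom e" "u = Atom d" "v = r" "e \<in> D"
      "\<And>\<sigma>. subst \<sigma> r = r"
  | e d X Y X' Y' r where "(App (Atom e) (App (App (Atom d) (Var 1)) (Var 0)), r) \<in> R"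
      "t = Atom e" "u = App (App (Atom d) X) Y" "v = subst (case_nat Y' (\<lambda>_. X')) r"
      "e \<in> D" "d \<notin> D" "par R X X'" "par R Y Y'"
      "\<And>\<sigma> \<tau>. \<sigma> 0 = \<tau> 0 \<Longrightarrow> \<sigma> 1 = \<tau> 1 \<Longrightarrow> subst \<sigma> r = subst \<tau> r"
  using assms
proof (rule par_AppE)
  fix l r \<sigma> \<tau>
  assume 3: "App t u = subst \<sigma> l" "v = subst \<tau> r" "(l, r) \<in> R" "\<And>i. par R (\<sigma> i) (\<tau> i)"
  show ?thesis
  proof (cases rule: lhs_cases[OF 3(3)])
    case (1 e d)
    then have "t = Atom e" "u = Atom d" "v = r" using 3(1,2) by simp_all
    then show ?thesis using that(3)[of e d r] 1 3(3) by blast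
  next
    case (2 e d)
    have "v = subst (case_nat (\<tau> 0) (\<lambda>_. \<tau> 1)) r"
      using 3 2(4)[of \<tau> "case_nat (\<tau> 0) (\<lambda>_. \<tau> 1)"] by simp
    moreover have "t = Atom e" "u = App (App (Atom d) (\<sigma> 1)) (\<sigma> 0)" using 3(1) 2(3) by simp_all
    ultimately show ?thesis using that(4)[of e d r] 2 3(3,4) by blast
  qed
qed (use that in blast)+

text \<open>Since \<open>d\<close> is not in \<open>D\<close>, no left-hand side is headed by it,
  and an atom is not an abstraction. Only congruence steps remain, so the shape of a rule argument
  survives reduction.\<close>

lemma par_constr_App:
  assumes "d \<notin> D" "par R (App (App (Atom d) X) Y) v"
  shows "\<exists>X' Y'. v = App (App (Atom d) X') Y' \<and> par R X X' \<and> par R Y Y'"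
proof -
  have "\<exists>X'. w = App (Atom d) X' \<and> par R X X'" if "par R (App (Atom d) X) w" for w
    using that by (rule par_App_inv) (use assms(1) in \<open>auto simp: par_inv\<close>)
  note * = this
  show ?thesis using assms(2) by (rule par_App_inv) (use * in auto)
qed

text \<open>Takahashi's triangle property, which implies the diamond property of \<open>par\<close>.\<close>

lemma par_complete: "\<exists>w. \<forall>v. par R t v \<longrightarrow> par R v w"
proof (induction t rule: measure_induct_rule[of size])
  case (less t)
  show ?case
  proof (cases t)
    case (Pi A B)
    obtain A' B' where "\<forall>v. par R A v \<longrightarrow> par R v A'" "\<forall>v. par R B v \<longrightarrow> par R v B'"
      using less[of A] less[of B] Pi by auto
    then have "\<forall>v. par R t v \<longrightarrow> par R v (Pi A' B')" by (auto simp: Pi par_inv)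
    then show ?thesis ..
  next
    case (Lam A B)
    obtain A' B' where "\<forall>v. par R A v \<longrightarrow> par R v A'" "\<forall>v. par R B v \<longrightarrow> par R v B'"
      using less[of A] less[of B] Lam by auto
    then have "\<forall>v. par R t v \<longrightarrow> par R v (Lam A' B')" by (auto simp: Lam par_inv)
    then show ?thesis ..
  next
    case (App f a)
    obtain a' where a': "\<And>v. par R a v \<Longrightarrow> par R v a'" using less[of a] App by auto
    obtain f' where f': "\<And>v. par R f v \<Longrightarrow> par R v f'" using less[of f] App by auto
    \<comment> \<open>\<open>w\<close> contracts the root redex whenever there is one, on top of the
      developments of the parts, so the cases follow the shape of that redex.\<close>
    consider (beta) A b where "f = Lam A b"
      | (r1) e d r where "(App (Atom e) (Atom d), r) \<in> R" "f = Atom e" "a = Atom d"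
      | (r2) e d X Y r where "(App (Atom e) (App (App (Atom d) (Var 1)) (Var 0)), r) \<in> R"
          "f = Atom e" "a = App (App (Atom d) X) Y"
      | (other) "\<nexists>A b. f = Lam A b"
          "\<nexists>e d r. (App (Atom e) (Atom d), r) \<in> R \<and> f = Atom e \<and> a = Atom d"
          "\<nexists>e d X Y r. (App (Atom e) (App (App (Atom d) (Var 1)) (Var 0)), r) \<in> R \<and>
             f = Atom e \<and> a = App (App (Atom d) X) Y"
      by blast
    then show ?thesis
    proof cases
      case (beta A b)
      obtain b' where b': "\<And>v. par R b v \<Longrightarrow> par R v b'" using less[of b] App beta by auto
      have "par R v (inst a' b')" if "par R t v" for v
        using that unfolding App
        by (rule par_App_inv) (use beta in \<open>auto simp: par_inv intro: par.par_beta par_inst a' b'\<close>)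
      then show ?thesis by blast
    next
      case (r1 e d r)
      have "par R v r" if "par R t v" for v
        using that unfolding App
      proof (rule par_App_inv)
        fix t' u' assume "v = App t' u'" "par R f t'" "par R a u'"
        then have "v = subst Var (App (Atom e) (Atom d))" using r1 by (auto simp: par_inv)
        then show ?thesis using par_rewrite[OF r1(1), of Var Var] by simp
      qed (use r1(2,3) in \<open>auto dest!: rule_unique[OF r1(1)]\<close>)
      then show ?thesis by blast
    next
      case (r2 e d X Y r)
      obtain X' where X': "\<And>v. par R X v \<Longrightarrow> par R v X'" using less[of X] App r2 by auto
      obtain Y' where Y': "\<And>v. par R Y v \<Longrightarrow> par R v Y'" using less[of Y] App r2 by auto
      have d: "d \<notin> D" using lhs_cases[OF r2(1)] by auto
      have "par R v (subst (case_nat Y' (\<lambda>_. X')) r)" if "par R t v" for v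
        using that unfolding App
      proof (rule par_App_inv)
        fix t' u' assume v: "v = App t' u'" "par R f t'" "par R a u'"
        then obtain X'' Y'' where u': "u' = App (App (Atom d) X'') Y''" "par R X X''" "par R Y Y''"
          using par_constr_App[OF d] r2 by blast
        then have "v = subst (case_nat Y'' (\<lambda>_. X'')) (App (Atom e) (App (App (Atom d) (Var 1)) (Var 0)))"
          using v r2 by (auto simp: par_inv)
        then show ?thesis
          using par_rewrite[OF r2(1), of "case_nat Y'' (\<lambda>_. X'')" "case_nat Y' (\<lambda>_. X')"] u' X' Y'
          by (simp split: nat.split)
      next
        fix e' d' X0 Y0 X'' Y'' r'
        assume *: "(App (Atom e') (App (App (Atom d') (Var 1)) (Var 0)), r') \<in> R"
          "f = Atom e'" "a = App (App (Atom d') X0) Y0" "v = subst (case_nat Y'' (\<lambda>_. X'')) r'"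
          "par R X0 X''" "par R Y0 Y''"
        then have "r' = r" using r2 rule_unique by auto
        then show ?thesis using * r2 X' Y' by (auto intro!: par_subst split: nat.split)
      qed (use r2 in auto)
      then show ?thesis by blast
    next
      case other
      have "par R v (App f' a')" if "par R t v" for v
        using that unfolding App
        by (rule par_App_inv) (use other in \<open>auto intro: par.par_App f' a'\<close>)
      then show ?thesis by blast
    qed
  qed (auto simp: par_inv)
qed

lemma confluentp_red: "confluentp (red R)"
proof -
  have "strong_confluentp (par R)"
  proof
    fix x y z assume "par R x y" "par R x z"
    with par_complete[of x] obtain w where "par R y w" "par R z w" by blast
    then show "\<exists>u. (par R)\<^sup>*\<^sup>* y u \<and> (par R)\<^sup>=\<^sup>= z u" by blast
  qed
  then have "confluentp (par R)" by (rule strong_confluentp_imp_confluentp)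
  moreover have "(par R)\<^sup>*\<^sup>* = (red R)\<^sup>*\<^sup>*"
    by (rule rtranclp_subset) (auto intro: red_par par_reds)
  ultimately show ?thesis by (simp add: confluentp_def rtranclp_conversep)
qed

section \<open>Consequences of confluence for atoms and products\<close>

lemma conv_common_reduct:
  assumes "conv R t u"
  obtains w where "(red R)\<^sup>*\<^sup>* t w" "(red R)\<^sup>*\<^sup>* u w"
  using assms semiconfluentp_equivclp[OF confluentp_imp_semiconfluentp[OF confluentp_red]]
  unfolding conv_def by (auto simp: rtranclp_conversep OO_def)

lemma reds_pars: "(red R)\<^sup>*\<^sup>* t u \<Longrightarrow> (par R)\<^sup>*\<^sup>* t u"
  by (rule rtranclp_mono[THEN predicate2D, rotated]) (auto intro: red_par)

lemma reds_Atom: "(red R)\<^sup>*\<^sup>* (Atom a) u \<Longrightarrow> u = Atom a"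
  by (drule reds_pars, induction rule: rtranclp_induct) (auto simp: par_inv)

lemma reds_PiD:
  "(red R)\<^sup>*\<^sup>* (Pi A B) u \<Longrightarrow> \<exists>A' B'. u = Pi A' B' \<and> (red R)\<^sup>*\<^sup>* A A' \<and> (red R)\<^sup>*\<^sup>* B B'"
proof (drule reds_pars, induction rule: rtranclp_induct)
  case (step u v)
  then show ?case by (auto simp: par_inv) (meson par_reds rtranclp_trans)+
qed simp

lemma conv_AtomD: "conv R t (Atom a) \<Longrightarrow> (red R)\<^sup>*\<^sup>* t (Atom a)"
  by (erule conv_common_reduct) (auto dest: reds_Atom)

lemma conv_Atom_Atom: "conv R (Atom a) (Atom b) \<longleftrightarrow> a = b"
  by (auto dest: conv_AtomD reds_Atom)

lemma conv_PiD:
  assumes "conv R t (Pi A B)"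
  obtains A' B' where "(red R)\<^sup>*\<^sup>* t (Pi A' B')" "(red R)\<^sup>*\<^sup>* A A'" "(red R)\<^sup>*\<^sup>* B B'"
  using assms by (rule conv_common_reduct) (use that in \<open>auto dest: reds_PiD\<close>)

lemma conv_Atom_Pi: "\<not> conv R (Atom a) (Pi A B)"
  by (auto elim!: conv_PiD dest: reds_Atom)

lemma Pi_injective:
  assumes "conv R (Pi A B) (Pi A' B')"
  shows "conv R A A'" "conv R B B'"
proof -
  obtain A0 B0 where "(red R)\<^sup>*\<^sup>* (Pi A B) (Pi A0 B0)" "(red R)\<^sup>*\<^sup>* A' A0" "(red R)\<^sup>*\<^sup>* B' B0"
    using conv_PiD[OF assms] .
  then show "conv R A A'" "conv R B B'"
    by (auto dest!: reds_PiD) (meson conv_trans reds_conv conv_sym)+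
qed

end


section \<open>Type systems modulo rewriting\<close>

text \<open>With this name the type of a variable satisfies the recursion \<open>ty_simps\<close>
  over the context, so that all later arguments lift by one position at a time.\<close>

definition ty :: "'a trm list \<Rightarrow> nat \<Rightarrow> 'a trm" where
  "ty \<Gamma> i = lift (Suc i) (\<Gamma> ! i)"

lemma ty_simps [simp]: "ty (A # \<Gamma>) 0 = ren Suc A" "ty (A # \<Gamma>) (Suc i) = ren Suc (ty \<Gamma> i)"
  by (simp_all add: ty_def lift_def ren_ren o_def)

text \<open>
  Both calculi are instances of one parametric system. Its conversion rule comes in two versions:
  for \<open>b = True\<close> the source type must have the same sort as the target type, as in the
  definitions of the two calculi; for \<open>b = False\<close> it need not be typed by a sort. Subject reduction has a
  direct proof for the latter only, and implies that the two versions agree.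
\<close>

locale tsys =
  fixes S :: "'a set" and Ax :: "('a \<times> 'a) set" and Rl :: "('a \<times> 'a \<times> 'a) set"
    and Sg :: "('a \<times> 'a trm) set" and R :: "('a trm \<times> 'a trm) set" and D :: "'a set"
  assumes orth: "orthogonal D R"
    and Ax_S: "(a, s) \<in> Ax \<Longrightarrow> s \<in> S"
    and Rl_S: "(s1, s2, s3) \<in> Rl \<Longrightarrow> s1 \<in> S \<and> s2 \<in> S \<and> s3 \<in> S"
    and Sg_S: "(c, A) \<in> Sg \<Longrightarrow> c \<notin> S"
    and Sg_closed: "(c, A) \<in> Sg \<Longrightarrow> subst \<sigma> A = A"
    and Ax_functional: "(a, s) \<in> Ax \<Longrightarrow> (a, s') \<in> Ax \<Longrightarrow> s = s'"
    and Rl_functional: "(s1, s2, s3) \<in> Rl \<Longrightarrow> (s1, s2, s3') \<in> Rl \<Longrightarrow> s3 = s3'"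
    and Sg_functional: "(c, A) \<in> Sg \<Longrightarrow> (c, A') \<in> Sg \<Longrightarrow> A = A'"
    and Ax_Sg: "(a, s) \<in> Ax \<Longrightarrow> (a, A) \<notin> Sg"
begin

inductive wfctx :: "bool \<Rightarrow> 'a trm list \<Rightarrow> bool"
  and typed :: "bool \<Rightarrow> 'a trm list \<Rightarrow> 'a trm \<Rightarrow> 'a trm \<Rightarrow> bool"
  for b :: bool where
  wf_empty: "wfctx b []"
| wf_decl: "typed b \<Gamma> A (Atom s) \<Longrightarrow> s \<in> S \<Longrightarrow> wfctx b (A # \<Gamma>)"
| typ_sort: "wfctx b \<Gamma> \<Longrightarrow> (s1, s2) \<in> Ax \<Longrightarrow> typed b \<Gamma> (Atom s1) (Atom s2)"
| typ_const: "wfctx b \<Gamma> \<Longrightarrow> (c, A) \<in> Sg \<Longrightarrow> typed b [] A (Atom s) \<Longrightarrow> s \<in> S \<Longrightarrow> typed b \<Gamma> (Atom c) A"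
| typ_var: "wfctx b \<Gamma> \<Longrightarrow> i < length \<Gamma> \<Longrightarrow> typed b \<Gamma> (Var i) (ty \<Gamma> i)"
| typ_prod: "typed b \<Gamma> A (Atom s1) \<Longrightarrow> typed b (A # \<Gamma>) B (Atom s2) \<Longrightarrow> (s1, s2, s3) \<in> Rl \<Longrightarrow>
    typed b \<Gamma> (Pi A B) (Atom s3)"
| typ_abs: "typed b \<Gamma> A (Atom s1) \<Longrightarrow> typed b (A # \<Gamma>) B (Atom s2) \<Longrightarrow> typed b (A # \<Gamma>) t B \<Longrightarrow>
    (s1, s2, s3) \<in> Rl \<Longrightarrow> typed b \<Gamma> (Lam A t) (Pi A B)"
| typ_app: "typed b \<Gamma> t (Pi A B) \<Longrightarrow> typed b \<Gamma> u A \<Longrightarrow> typed b \<Gamma> (App t u) (inst u B)"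
| typ_conv: "typed b \<Gamma> t A \<Longrightarrow> conv R A B \<Longrightarrow> typed b \<Gamma> B (Atom s) \<Longrightarrow> s \<in> S \<Longrightarrow>
    (b \<Longrightarrow> typed b \<Gamma> A (Atom s)) \<Longrightarrow> typed b \<Gamma> t B"

text \<open>The mutual induction with a trivial predicate for contexts: well-formed contexts appear
  as plain premises, while the typing of a constant's type keeps its induction hypothesis.\<close>

lemma typ_induct [consumes 1, case_names sort const var prod abs app conv]:
  assumes "typed b \<Gamma> t T"
    and "\<And>\<Gamma> s1 s2. wfctx b \<Gamma> \<Longrightarrow> (s1, s2) \<in> Ax \<Longrightarrow> Q \<Gamma> (Atom s1) (Atom s2)"
    and "\<And>\<Gamma> c A s. wfctx b \<Gamma> \<Longrightarrow> (c, A) \<in> Sg \<Longrightarrow> typed b [] A (Atom s) \<Longrightarrow> Q [] A (Atom s) \<Longrightarrow> s \<in> S \<Longrightarrow>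
      Q \<Gamma> (Atom c) A"
    and "\<And>\<Gamma> i. wfctx b \<Gamma> \<Longrightarrow> i < length \<Gamma> \<Longrightarrow> Q \<Gamma> (Var i) (ty \<Gamma> i)"
    and "\<And>\<Gamma> A s1 B s2 s3. typed b \<Gamma> A (Atom s1) \<Longrightarrow> Q \<Gamma> A (Atom s1) \<Longrightarrow> typed b (A # \<Gamma>) B (Atom s2) \<Longrightarrow>
      Q (A # \<Gamma>) B (Atom s2) \<Longrightarrow> (s1, s2, s3) \<in> Rl \<Longrightarrow> Q \<Gamma> (Pi A B) (Atom s3)"
    and "\<And>\<Gamma> A s1 B s2 t s3. typed b \<Gamma> A (Atom s1) \<Longrightarrow> Q \<Gamma> A (Atom s1) \<Longrightarrow> typed b (A # \<Gamma>) B (Atom s2) \<Longrightarrow>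
      Q (A # \<Gamma>) B (Atom s2) \<Longrightarrow> typed b (A # \<Gamma>) t B \<Longrightarrow> Q (A # \<Gamma>) t B \<Longrightarrow> (s1, s2, s3) \<in> Rl \<Longrightarrow>
      Q \<Gamma> (Lam A t) (Pi A B)"
    and "\<And>\<Gamma> t A B u. typed b \<Gamma> t (Pi A B) \<Longrightarrow> Q \<Gamma> t (Pi A B) \<Longrightarrow> typed b \<Gamma> u A \<Longrightarrow> Q \<Gamma> u A \<Longrightarrow>
      Q \<Gamma> (App t u) (inst u B)"
    and "\<And>\<Gamma> t A B s. typed b \<Gamma> t A \<Longrightarrow> Q \<Gamma> t A \<Longrightarrow> conv R A B \<Longrightarrow> typed b \<Gamma> B (Atom s) \<Longrightarrow> Q \<Gamma> B (Atom s) \<Longrightarrow>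
      s \<in> S \<Longrightarrow> (b \<Longrightarrow> typed b \<Gamma> A (Atom s)) \<Longrightarrow> (b \<Longrightarrow> Q \<Gamma> A (Atom s)) \<Longrightarrow> Q \<Gamma> t B"
  shows "Q \<Gamma> t T"
  by (rule wfctx_typed.inducts(2)[OF assms(1), where ?P1.0 = "\<lambda>_. True"]) (blast intro: assms(2-))+

lemma typ_wf: "typed b \<Gamma> t T \<Longrightarrow> wfctx b \<Gamma>"
  by (induction rule: typ_induct) auto

lemma wf_ConsD: "wfctx b (A # \<Gamma>) \<Longrightarrow> \<exists>s\<in>S. typed b \<Gamma> A (Atom s)"
  by (auto elim: wfctx.cases)

lemma wf_Cons: "typed b \<Gamma> A (Atom s) \<Longrightarrow> (s, s2, s3) \<in> Rl \<Longrightarrow> wfctx b (A # \<Gamma>)"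
  using Rl_S wf_decl by blast


subsection \<open>Renaming and substitution\<close>

definition ren_ok :: "bool \<Rightarrow> 'a trm list \<Rightarrow> 'a trm list \<Rightarrow> (nat \<Rightarrow> nat) \<Rightarrow> bool" where
  "ren_ok b \<Gamma> \<Delta> f \<longleftrightarrow> wfctx b \<Delta> \<and> (\<forall>i<length \<Gamma>. f i < length \<Delta> \<and> ty \<Delta> (f i) = ren f (ty \<Gamma> i))"

lemma ren_ok_up:
  assumes "ren_ok b \<Gamma> \<Delta> f" "wfctx b (ren f A # \<Delta>)"
  shows "ren_ok b (A # \<Gamma>) (ren f A # \<Delta>) (up_ren f)"
  unfolding ren_ok_def
proof (intro conjI allI impI assms(2))
  fix i assume "i < length (A # \<Gamma>)"
  with assms(1) show "up_ren f i < length (ren f A # \<Delta>)"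
      "ty (ren f A # \<Delta>) (up_ren f i) = ren (up_ren f) (ty (A # \<Gamma>) i)"
    by (cases i; simp add: ren_ok_def ren_up_Suc)+
qed

lemma typ_ren: "typed b \<Gamma> t T \<Longrightarrow> ren_ok b \<Gamma> \<Delta> f \<Longrightarrow> typed b \<Delta> (ren f t) (ren f T)"
proof (induction arbitrary: \<Delta> f rule: typ_induct)
  case (const \<Gamma> c A s)
  then show ?case
    using typ_const[of b \<Delta> c A s] closed_ren[OF Sg_closed[OF const(2)]] by (simp add: ren_ok_def)
next
  case (prod \<Gamma> A s1 B s2 s3)
  then have "wfctx b (ren f A # \<Delta>)" using wf_Cons by fastforce
  then show ?case using prod ren_ok_up by (auto intro!: typ_prod)
next
  case (abs \<Gamma> A s1 B s2 t s3)
  then have "wfctx b (ren f A # \<Delta>)" using wf_Cons by fastforce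
  then show ?case using abs ren_ok_up by (auto intro!: typ_abs)
next
  case (app \<Gamma> t A B u)
  then show ?case by (auto simp: ren_inst intro!: typ_app)
next
  case (conv \<Gamma> t A B s)
  show ?case by (rule typ_conv[of b \<Delta> _ "ren f A" _ s]) (use conv in \<open>auto simp: conv_ren\<close>)
next
  case (var \<Gamma> i)
  then show ?case using typ_var[of b \<Delta> "f i"] by (simp add: ren_ok_def)
qed (auto simp: ren_ok_def intro: typ_sort)

lemma ren_ok_Suc: "wfctx b (A # \<Gamma>) \<Longrightarrow> ren_ok b \<Gamma> (A # \<Gamma>) Suc"
  by (simp add: ren_ok_def)

lemma weakening: "typed b \<Gamma> t T \<Longrightarrow> wfctx b (A # \<Gamma>) \<Longrightarrow> typed b (A # \<Gamma>) (ren Suc t) (ren Suc T)"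
  by (blast intro: typ_ren ren_ok_Suc)

definition sub_ok :: "bool \<Rightarrow> 'a trm list \<Rightarrow> 'a trm list \<Rightarrow> (nat \<Rightarrow> 'a trm) \<Rightarrow> bool" where
  "sub_ok b \<Gamma> \<Delta> \<sigma> \<longleftrightarrow> wfctx b \<Delta> \<and> (\<forall>i<length \<Gamma>. typed b \<Delta> (\<sigma> i) (subst \<sigma> (ty \<Gamma> i)))"

lemma sub_ok_up:
  assumes "sub_ok b \<Gamma> \<Delta> \<sigma>" "wfctx b (subst \<sigma> A # \<Delta>)"
  shows "sub_ok b (A # \<Gamma>) (subst \<sigma> A # \<Delta>) (up_subst \<sigma>)"
  unfolding sub_ok_def
proof (intro conjI allI impI assms(2))
  fix i assume i: "i < length (A # \<Gamma>)"
  show "typed b (subst \<sigma> A # \<Delta>) (up_subst \<sigma> i) (subst (up_subst \<sigma>) (ty (A # \<Gamma>) i))"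
  proof (cases i)
    case 0
    then show ?thesis using typ_var[OF assms(2), of 0] by (simp add: subst_up_Suc)
  next
    case (Suc j)
    then show ?thesis using assms i by (auto simp: sub_ok_def subst_up_Suc weakening)
  qed
qed

lemma typ_subst: "typed b \<Gamma> t T \<Longrightarrow> sub_ok b \<Gamma> \<Delta> \<sigma> \<Longrightarrow> typed b \<Delta> (subst \<sigma> t) (subst \<sigma> T)"
proof (induction arbitrary: \<Delta> \<sigma> rule: typ_induct)
  case (const \<Gamma> c A s)
  then show ?case
    using typ_const[of b \<Delta> c A s] Sg_closed[OF const(2)] by (simp add: sub_ok_def)
next
  case (prod \<Gamma> A s1 B s2 s3)
  then have "wfctx b (subst \<sigma> A # \<Delta>)" using wf_Cons by fastforce
  then show ?case using prod sub_ok_up by (auto intro!: typ_prod)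
next
  case (abs \<Gamma> A s1 B s2 t s3)
  then have "wfctx b (subst \<sigma> A # \<Delta>)" using wf_Cons by fastforce
  then show ?case using abs sub_ok_up by (auto intro!: typ_abs)
next
  case (app \<Gamma> t A B u)
  then show ?case by (auto simp: subst_inst intro!: typ_app)
next
  case (conv \<Gamma> t A B s)
  show ?case by (rule typ_conv[of b \<Delta> _ "subst \<sigma> A" _ s]) (use conv in \<open>auto simp: conv_subst\<close>)
qed (auto simp: sub_ok_def intro: typ_sort)

lemma sub_ok_inst:
  assumes "typed b \<Gamma> u A"
  shows "sub_ok b (A # \<Gamma>) \<Gamma> (case_nat u Var)"
  unfolding sub_ok_def
proof (intro conjI allI impI)
  show wfctx: "wfctx b \<Gamma>" using assms by (rule typ_wf)
  fix i assume "i < length (A # \<Gamma>)"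
  then show "typed b \<Gamma> (case i of 0 \<Rightarrow> u | Suc x \<Rightarrow> Var x) (subst (case_nat u Var) (ty (A # \<Gamma>) i))"
    using assms typ_var[OF wfctx] by (cases i) (simp_all flip: inst_eq)
qed

lemma typ_inst: "typed b (A # \<Gamma>) t B \<Longrightarrow> typed b \<Gamma> u A \<Longrightarrow> typed b \<Gamma> (inst u t) (inst u B)"
  unfolding inst_eq by (blast intro: typ_subst sub_ok_inst)

text \<open>Replacing the type of a declaration is the identity substitution into the new context,
  where variable 0 regains its old type by conversion. Both types have the same sort so that the
  strict conversion rule applies too.\<close>

lemma sub_ok_context_conv:
  assumes "wfctx b (A # \<Gamma>)" "conv R A' A" "typed b \<Gamma> A (Atom s)" "typed b \<Gamma> A' (Atom s)" "s \<in> S"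
  shows "sub_ok b (A # \<Gamma>) (A' # \<Gamma>) Var"
proof -
  have wfctx: "wfctx b (A' # \<Gamma>)" using assms wf_decl by blast
  have "typed b (A' # \<Gamma>) (Var i) (ty (A # \<Gamma>) i)" if "i < length (A # \<Gamma>)" for i
  proof (cases i)
    case 0
    have "typed b (A' # \<Gamma>) (Var 0) (ren Suc A)"
      by (rule typ_conv[where s = s and A = "ren Suc A'"])
        (use typ_var[OF wfctx, of 0] weakening[OF assms(3) wfctx] weakening[OF assms(4) wfctx] assms
          in \<open>auto simp: conv_ren\<close>)
    then show ?thesis by (simp add: 0)
  next
    case (Suc j)
    then show ?thesis using typ_var[OF wfctx, of i] that by simp
  qed
  then show ?thesis using wfctx by (simp add: sub_ok_def)
qed

lemma typ_context_conv:
  assumes "typed b (A # \<Gamma>) t T" "conv R A A'" "typed b \<Gamma> A (Atom s)" "typed b \<Gamma> A' (Atom s)" "s \<in> S"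
  shows "typed b (A' # \<Gamma>) t T"
  using typ_subst[OF assms(1) sub_ok_context_conv[OF typ_wf[OF assms(1)] conv_sym[OF assms(2)] assms(3-5)]]
  by simp


subsection \<open>Generation, correctness and uniqueness of types\<close>

lemma gen_Var: "typed b \<Gamma> (Var i) T \<Longrightarrow> i < length \<Gamma> \<and> conv R (ty \<Gamma> i) T"
  by (induction \<Gamma> "Var i :: 'a trm" T rule: typ_induct) (auto intro: conv_trans)

lemma gen_Atom:
  "typed b \<Gamma> (Atom a) T \<Longrightarrow> (\<exists>s. (a, s) \<in> Ax \<and> conv R (Atom s) T) \<or>
     (\<exists>A s. (a, A) \<in> Sg \<and> typed b [] A (Atom s) \<and> s \<in> S \<and> conv R A T)"
  by (induction \<Gamma> "Atom a :: 'a trm" T rule: typ_induct) (blast intro: conv_trans conv_refl)+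

lemma gen_Pi:
  assumes "typed b \<Gamma> (Pi A B) T"
  obtains s1 s2 s3 where "typed b \<Gamma> A (Atom s1)" "typed b (A # \<Gamma>) B (Atom s2)" "(s1, s2, s3) \<in> Rl"
    "conv R (Atom s3) T"
proof -
  have "\<exists>s1 s2 s3. typed b \<Gamma> A (Atom s1) \<and> typed b (A # \<Gamma>) B (Atom s2) \<and> (s1, s2, s3) \<in> Rl \<and>
      conv R (Atom s3) T"
    using assms by (induction \<Gamma> "Pi A B" T rule: typ_induct) (blast intro: conv_trans conv_refl)+
  then show ?thesis using that by blast
qed

lemma gen_Lam:
  assumes "typed b \<Gamma> (Lam A t) T"
  obtains s1 s2 s3 B where "typed b \<Gamma> A (Atom s1)" "typed b (A # \<Gamma>) B (Atom s2)" "typed b (A # \<Gamma>) t B"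
    "(s1, s2, s3) \<in> Rl" "conv R (Pi A B) T"
proof -
  have "\<exists>s1 s2 s3 B. typed b \<Gamma> A (Atom s1) \<and> typed b (A # \<Gamma>) B (Atom s2) \<and> typed b (A # \<Gamma>) t B \<and>
      (s1, s2, s3) \<in> Rl \<and> conv R (Pi A B) T"
    using assms by (induction \<Gamma> "Lam A t" T rule: typ_induct) (blast intro: conv_trans conv_refl)+
  then show ?thesis using that by blast
qed

lemma gen_App:
  assumes "typed b \<Gamma> (App t u) T"
  obtains A B where "typed b \<Gamma> t (Pi A B)" "typed b \<Gamma> u A" "conv R (inst u B) T"
proof -
  have "\<exists>A B. typed b \<Gamma> t (Pi A B) \<and> typed b \<Gamma> u A \<and> conv R (inst u B) T"
    using assms by (induction \<Gamma> "App t u" T rule: typ_induct) (blast intro: conv_trans conv_refl)+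
  then show ?thesis using that by blast
qed

lemma typ_ty: "wfctx b \<Gamma> \<Longrightarrow> i < length \<Gamma> \<Longrightarrow> \<exists>s\<in>S. typed b \<Gamma> (ty \<Gamma> i) (Atom s)"
proof (induction \<Gamma> arbitrary: i)
  case (Cons A \<Gamma>)
  then obtain s where s: "s \<in> S" "typed b \<Gamma> A (Atom s)" using wf_ConsD by blast
  show ?case
  proof (cases i)
    case 0
    then show ?thesis using weakening[OF s(2) Cons.prems(1)] s(1) by auto
  next
    case (Suc j)
    then obtain s' where "s' \<in> S" "typed b \<Gamma> (ty \<Gamma> j) (Atom s')" using Cons s typ_wf by fastforce
    then show ?thesis using weakening[OF _ Cons.prems(1), of "ty \<Gamma> j" "Atom s'"] Suc by auto
  qed
qed simp

text \<open>The second alternative covers sorts without a type of their own, such as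
  \<open>Kind\<close>: they can still be types, as targets of an axiom or a rule.\<close>

definition valid :: "bool \<Rightarrow> 'a trm list \<Rightarrow> 'a trm \<Rightarrow> bool" where
  "valid b \<Gamma> T \<longleftrightarrow> (\<exists>s\<in>S. typed b \<Gamma> T (Atom s)) \<or>
     (\<exists>s. T = Atom s \<and> ((\<exists>a. (a, s) \<in> Ax) \<or> (\<exists>s1 s2. (s1, s2, s) \<in> Rl)))"

lemma valid_Pi: "valid b \<Gamma> (Pi A B) \<Longrightarrow> \<exists>s. typed b \<Gamma> (Pi A B) (Atom s)"
  by (auto simp: valid_def)

lemma typ_valid: "typed b \<Gamma> t T \<Longrightarrow> valid b \<Gamma> T"
proof (induction rule: typ_induct)
  case (const \<Gamma> c A s)
  have "typed b \<Gamma> A (Atom s)"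
    using typ_subst[OF const(3), of \<Gamma> Var] const(1) by (simp add: sub_ok_def)
  then show ?case using \<open>s \<in> S\<close> by (auto simp: valid_def)
next
  case (var \<Gamma> i)
  then show ?case using typ_ty by (auto simp: valid_def)
next
  case (abs \<Gamma> A s1 B s2 t s3)
  then show ?case using typ_prod Rl_S unfolding valid_def by blast
next
  case (app \<Gamma> t A B u)
  then obtain s where "typed b \<Gamma> (Pi A B) (Atom s)" using valid_Pi by blast
  then obtain s1 s2 s3 where "typed b (A # \<Gamma>) B (Atom s2)" "(s1, s2, s3) \<in> Rl" by (rule gen_Pi)
  then have "typed b \<Gamma> (inst u B) (inst u (Atom s2))" "s2 \<in> S" using app typ_inst Rl_S by blast+
  then show ?case by (auto simp: valid_def inst_eq)
qed (auto simp: valid_def)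

lemma typ_unique: "typed b \<Gamma> t T \<Longrightarrow> typed b \<Gamma> t T' \<Longrightarrow> conv R T T'"
proof (induction t arbitrary: \<Gamma> T T')
  case (Var i)
  then show ?case by (meson gen_Var conv_sym conv_trans)
next
  case (Atom a)
  have "\<exists>C. conv R C T \<and> conv R C T'"
    using gen_Atom[OF Atom(1)] gen_Atom[OF Atom(2)]
    by (elim disjE exE conjE) (blast dest: Ax_functional Sg_functional Ax_Sg)+
  then show ?case using conv_sym conv_trans by blast
next
  case (Pi A B)
  obtain s1 s2 s3 where 1: "typed b \<Gamma> A (Atom s1)" "typed b (A # \<Gamma>) B (Atom s2)" "(s1, s2, s3) \<in> Rl"
    "conv R (Atom s3) T" using gen_Pi[OF Pi.prems(1)] .
  obtain s1' s2' s3' where 2: "typed b \<Gamma> A (Atom s1')" "typed b (A # \<Gamma>) B (Atom s2')"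
    "(s1', s2', s3') \<in> Rl" "conv R (Atom s3') T'" using gen_Pi[OF Pi.prems(2)] .
  have "s1 = s1'" "s2 = s2'"
    using Pi.IH(1)[OF 1(1) 2(1)] Pi.IH(2)[OF 1(2) 2(2)] conv_Atom_Atom[OF orth] by blast+
  then have "s3 = s3'" using 1 2 Rl_functional by blast
  then show ?case using 1 2 conv_sym conv_trans by blast
next
  case (Lam A t)
  obtain B where 1: "typed b (A # \<Gamma>) t B" "conv R (Pi A B) T" using gen_Lam[OF Lam.prems(1)] by blast
  obtain B' where 2: "typed b (A # \<Gamma>) t B'" "conv R (Pi A B') T'" using gen_Lam[OF Lam.prems(2)] by blast
  have "conv R (Pi A B) (Pi A B')" using Lam.IH(2)[OF 1(1) 2(1)] by (simp add: conv_Pi)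
  then show ?case using 1 2 conv_sym conv_trans by blast
next
  case (App t u)
  obtain A B where 1: "typed b \<Gamma> t (Pi A B)" "conv R (inst u B) T" using gen_App[OF App.prems(1)] .
  obtain A' B' where 2: "typed b \<Gamma> t (Pi A' B')" "conv R (inst u B') T'" using gen_App[OF App.prems(2)] .
  have "conv R B B'" using App.IH(1)[OF 1(1) 2(1)] Pi_injective[OF orth] by blast
  then show ?case using 1 2 conv_inst conv_sym conv_trans conv_refl by metis
qed

lemma sort_unique: "typed b \<Gamma> t (Atom s) \<Longrightarrow> typed b \<Gamma> t (Atom s') \<Longrightarrow> s = s'"
  using typ_unique conv_Atom_Atom[OF orth] by blast

text \<open>Available before subject reduction, and used to establish its hypothesis on rewrite
  rules: a valid \<open>T\<close> either has a sort, so that conversion applies, or is an atom and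
  then equals \<open>Atom k\<close>.\<close>

lemma typed_Atom_conv:
  "typed False \<Gamma> t (Atom k) \<Longrightarrow> conv R (Atom k) T \<Longrightarrow> valid False \<Gamma> T \<Longrightarrow> typed False \<Gamma> t T"
  unfolding valid_def by (auto simp: conv_Atom_Atom[OF orth] intro: typ_conv)

end


subsection \<open>Subject reduction\<close>

inductive_cases red_AtomE: "red R (Atom a) u"
inductive_cases red_VarE: "red R (Var a) u"
inductive_cases red_PiE: "red R (Pi A B) u"
inductive_cases red_LamE: "red R (Lam A B) u"
inductive_cases red_AppE: "red R (App A B) u"

text \<open>Preservation of types by rewriting at the root is an assumption of its own because its
  proof for the embedding uses generation and product injectivity from \<open>tsys\<close>.\<close>

locale tsys_rew = tsys +
  assumes rew_typ: "(l, r) \<in> R \<Longrightarrow> typed False \<Gamma> (subst \<sigma> l) T \<Longrightarrow> typed False \<Gamma> (subst \<sigma> r) T"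
begin

lemma not_red_Var: "\<not> red R (Var i) u"
  by (auto elim!: red_VarE) (metis subst_lhs_cases[OF orth] trm.distinct)

lemma not_red_Atom: "\<not> red R (Atom a) u"
  by (auto elim!: red_AtomE) (metis subst_lhs_cases[OF orth] trm.distinct)

lemma red_Pi:
  assumes "red R (Pi A B) u"
  obtains A' where "u = Pi A' B" "red R A A'" | B' where "u = Pi A B'" "red R B B'"
  using assms by (rule red_PiE) (use that in \<open>blast | metis subst_lhs_cases[OF orth] trm.distinct\<close>)+

lemma red_Lam:
  assumes "red R (Lam A B) u"
  obtains A' where "u = Lam A' B" "red R A A'" | B' where "u = Lam A B'" "red R B B'"
  using assms by (rule red_LamE) (use that in \<open>blast | metis subst_lhs_cases[OF orth] trm.distinct\<close>)+

text \<open>Generation describes the abstraction only up to conversion, and injectivity of products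
  separates domain and codomain. The argument \<open>u\<close> then moves from \<open>A\<close> to
  \<open>A0\<close>. The strict rule would ask here for equal sorts of \<open>A\<close> and
  \<open>A0\<close>, which is \<open>conv_sort\<close>, a consequence of subject reduction.\<close>

lemma beta_typ:
  assumes "typed False \<Gamma> (Lam A0 t) (Pi A B)" "typed False \<Gamma> u A"
  shows "typed False \<Gamma> (inst u t) (inst u B)"
proof -
  obtain s1 s2 s3 B0 where 1: "typed False \<Gamma> A0 (Atom s1)" "typed False (A0 # \<Gamma>) t B0"
    "(s1, s2, s3) \<in> Rl" "conv R (Pi A0 B0) (Pi A B)" using gen_Lam[OF assms(1)] by metis
  obtain s where "typed False \<Gamma> (Pi A B) (Atom s)" using valid_Pi typ_valid[OF assms(1)] by blast
  then obtain s2' s1' s3' where 2: "typed False (A # \<Gamma>) B (Atom s2')" "(s1', s2', s3') \<in> Rl"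
    by (rule gen_Pi)
  have c: "conv R A A0" "conv R B0 B" using Pi_injective[OF orth 1(4)] conv_sym by blast+
  have u: "typed False \<Gamma> u A0" using typ_conv[OF assms(2) c(1) 1(1)] Rl_S[OF 1(3)] by blast
  have "typed False \<Gamma> (inst u B) (Atom s2')" using typ_inst[OF 2(1) assms(2)] by (simp add: inst_eq)
  then show ?thesis
    using typ_conv[OF typ_inst[OF 1(2) u] conv_inst[OF conv_refl c(2)]] Rl_S[OF 2(2)] by blast
qed

lemma subject_reduction: "typed False \<Gamma> t T \<Longrightarrow> red R t t' \<Longrightarrow> typed False \<Gamma> t' T"
proof (induction arbitrary: t' rule: typ_induct)
  case (prod \<Gamma> A s1 B s2 s3)
  from prod.prems show ?case
  proof (rule red_Pi)
    \<comment> \<open>The codomain was typed under the old domain. It is moved to the reduct, whose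
      sort comes from the induction hypothesis.\<close>
    fix A' assume "t' = Pi A' B" and A': "red R A A'"
    then show ?thesis
      using prod typ_prod typ_context_conv[OF prod(2) red_conv[OF A'] prod(1) prod.IH(1)[OF A']] Rl_S
      by blast
  qed (use prod typ_prod in blast)
next
  case (abs \<Gamma> A s1 B s2 t s3)
  from abs.prems show ?case
  proof (rule red_Lam)
    fix A' assume t': "t' = Lam A' t" and A': "red R A A'"
    note cc = typ_context_conv[OF _ red_conv[OF A'] abs(1) abs.IH(1)[OF A']]
    have "typed False \<Gamma> (Lam A' t) (Pi A' B)" using abs typ_abs A' cc Rl_S by blast
    moreover have "conv R (Pi A' B) (Pi A B)" using A' by (blast intro: conv_sym red_conv red.Pi_left)
    moreover have "typed False \<Gamma> (Pi A B) (Atom s3)" using abs typ_prod by blast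
    ultimately show ?thesis using t' typ_conv Rl_S abs by blast
  qed (use abs typ_abs in blast)
next
  case (app \<Gamma> t A B u)
  from app.prems show ?case
  proof (rule red_AppE)
    fix A0 t0 assume "t' = inst u t0" "t = Lam A0 t0"
    then show ?thesis using app beta_typ by blast
  next
    fix l r \<sigma> assume *: "App t u = subst \<sigma> l" "t' = subst \<sigma> r" "(l, r) \<in> R"
    then show ?thesis using rew_typ[OF *(3)] typ_app app by metis
  next
    fix u' assume t': "t' = App t u'" and u': "red R u u'"
    \<comment> \<open>Reducing the argument changes the assigned type to \<open>inst u' B\<close>.
      Converting back needs a sort for \<open>inst u B\<close>, obtained by inverting the
      product.\<close>
    obtain s where "typed False \<Gamma> (Pi A B) (Atom s)" using valid_Pi typ_valid app by blast
    then obtain s2' s1' s3' where 2: "typed False (A # \<Gamma>) B (Atom s2')" "(s1', s2', s3') \<in> Rl"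
      by (rule gen_Pi)
    have "typed False \<Gamma> (inst u B) (Atom s2')" using typ_inst[OF 2(1) app(2)] by (simp add: inst_eq)
    moreover have "typed False \<Gamma> t' (inst u' B)" using t' u' app typ_app by blast
    moreover have "conv R (inst u' B) (inst u B)" by (rule conv_inst) (use u' in \<open>blast intro: conv_sym red_conv conv_refl\<close>)+
    ultimately show ?thesis using typ_conv Rl_S 2 by blast
  qed (use app typ_app in blast)
next
  case (conv \<Gamma> t A B s)
  then show ?case using typ_conv by blast
qed (auto simp: not_red_Atom not_red_Var)

lemma subject_reductions: "(red R)\<^sup>*\<^sup>* t t' \<Longrightarrow> typed False \<Gamma> t T \<Longrightarrow> typed False \<Gamma> t' T"
  by (induction rule: rtranclp_induct) (auto intro: subject_reduction)

section \<open>Sorts of convertible types, and agreement of the two conversion rules\<close>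

lemma conv_sort:
  assumes "typed False \<Gamma> A (Atom s)" "typed False \<Gamma> B (Atom s')" "conv R A B"
  shows "s = s'"
proof -
  obtain C where "(red R)\<^sup>*\<^sup>* A C" "(red R)\<^sup>*\<^sup>* B C" using conv_common_reduct[OF orth assms(3)] .
  then show ?thesis using assms subject_reductions sort_unique by blast
qed

text \<open>Meant for a target that is a sort without a type, to which the conversion rule does not
  apply. If \<open>T\<close> has a sort, it reduces to that atom, which inherits the sort; otherwise
  \<open>T\<close> is itself an atom.\<close>

lemma typed_conv_Atom:
  assumes "typed False \<Gamma> t T" "conv R T T'" "(\<exists>s\<in>S. typed False \<Gamma> T' (Atom s)) \<or> (\<exists>a. T' = Atom a)"
  shows "typed False \<Gamma> t T'"
proof (cases "\<exists>s\<in>S. typed False \<Gamma> T (Atom s)")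
  case True
  then obtain s where s: "s \<in> S" "typed False \<Gamma> T (Atom s)" by blast
  show ?thesis
  proof (cases "\<exists>a. T' = Atom a")
    case True
    then have "typed False \<Gamma> T' (Atom s)"
      using s assms(2) conv_AtomD[OF orth] subject_reductions by blast
    then show ?thesis using assms s typ_conv by blast
  next
    case False
    then show ?thesis using assms(3) typ_conv[OF assms(1,2)] by auto
  qed
next
  case False
  then obtain a where a: "T = Atom a" using typ_valid[OF assms(1)] by (auto simp: valid_def)
  from assms(3) show ?thesis
  proof
    assume "\<exists>s\<in>S. typed False \<Gamma> T' (Atom s)"
    then show ?thesis using typ_conv[OF assms(1,2)] by auto
  next
    assume "\<exists>a. T' = Atom a"
    then show ?thesis using a assms(1,2) by (auto simp: conv_Atom_Atom[OF orth])
  qed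
qed

lemma strict_imp_relaxed: "typed True \<Gamma> t T \<Longrightarrow> typed False \<Gamma> t T"
proof -
  have "(wfctx True \<Gamma> \<longrightarrow> wfctx False \<Gamma>) \<and> (typed True \<Delta> t T \<longrightarrow> typed False \<Delta> t T)" for \<Gamma> \<Delta> t T
    by (rule wfctx_typed.induct) (blast intro: wfctx_typed.intros)+
  then show "typed True \<Gamma> t T \<Longrightarrow> typed False \<Gamma> t T" by blast
qed

text \<open>The missing premise is the sort \<open>s\<close> for \<open>A\<close>. If
  \<open>A\<close> has a sort, \<open>conv_sort\<close> identifies it with \<open>s\<close>.
  Otherwise \<open>A\<close> is a sort to which \<open>B\<close> reduces, and subject reduction
  yields the axiom that types it by \<open>s\<close>.\<close>

lemma conv_strict:
  assumes "typed True \<Gamma> t A" "conv R A B" "typed True \<Gamma> B (Atom s)" "s \<in> S"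
  shows "typed True \<Gamma> t B"
proof -
  have B: "typed False \<Gamma> B (Atom s)" using assms strict_imp_relaxed by blast
  have "typed True \<Gamma> A (Atom s)"
  proof (cases "\<exists>s'\<in>S. typed True \<Gamma> A (Atom s')")
    case True
    then show ?thesis using conv_sort[OF _ B assms(2)] strict_imp_relaxed by blast
  next
    case False
    then obtain s' where s': "A = Atom s'" "s' \<in> S"
      using typ_valid[OF assms(1)] Ax_S Rl_S by (auto simp: valid_def)
    then have "(red R)\<^sup>*\<^sup>* B (Atom s')" using assms(2) conv_sym conv_AtomD[OF orth] by blast
    then have "typed False \<Gamma> (Atom s') (Atom s)" using B subject_reductions by blast
    then have "(s', s) \<in> Ax" using gen_Atom[of False \<Gamma> s' "Atom s"] Sg_S s'(2)
      by (auto simp: conv_Atom_Atom[OF orth])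
    then show ?thesis using s'(1) typ_sort typ_wf[OF assms(1)] by blast
  qed
  then show ?thesis using assms typ_conv by blast
qed

lemma relaxed_imp_strict: "typed False \<Gamma> t T \<Longrightarrow> typed True \<Gamma> t T"
proof -
  have "(wfctx False \<Gamma> \<longrightarrow> wfctx True \<Gamma>) \<and> (typed False \<Delta> t T \<longrightarrow> typed True \<Delta> t T)" for \<Gamma> \<Delta> t T
    by (rule wfctx_typed.induct) (blast intro: wfctx_typed.intros conv_strict)+
  then show "typed False \<Gamma> t T \<Longrightarrow> typed True \<Gamma> t T" by blast
qed

lemma typ_False_eq: "typed False = typed True"
  by (intro ext) (blast intro: strict_imp_relaxed relaxed_imp_strict)

end


section \<open>The two instances\<close>

locale embedding =
  fixes P :: "'s pts"
  assumes is_pts: "is_pts P" and functional: "functional P"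
begin

text \<open>The instance has neither constants nor rewrite rules. Its set of sorts is
  \<open>UNIV\<close>, matching typing rules that impose no membership condition on sorts.\<close>

sublocale PT: tsys_rew UNIV "axms P" "ruls P" "{}" "{}" "{}"
  by unfold_locales (use functional in \<open>auto simp: functional_def orthogonal_empty\<close>)

lemma pts_typ_eq: "pts_typ P = PT.typed False"
proof -
  have "(pts_wf P \<Gamma> \<longrightarrow> PT.wfctx True \<Gamma>) \<and> (pts_typ P \<Delta> t T \<longrightarrow> PT.typed True \<Delta> t T)" for \<Gamma> \<Delta> t T
    by (rule pts_wf_pts_typ.induct) (blast intro: PT.wfctx_typed.intros PT.typ_var[unfolded ty_def])+
  moreover have "(PT.wfctx True \<Gamma> \<longrightarrow> pts_wf P \<Gamma>) \<and> (PT.typed True \<Delta> t T \<longrightarrow> pts_typ P \<Delta> t T)"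
    for \<Gamma> \<Delta> t T
    by (rule PT.wfctx_typed.induct)
      (blast intro: pts_wf_pts_typ.intros pts_var[folded ty_def])+
  ultimately show ?thesis unfolding PT.typ_False_eq by (intro ext) blast
qed

definition emb_Sg :: "('s emb_const lp_atom \<times> 's emb_trm) set" where
  "emb_Sg = {(Cst c, A) | c A. (c, A) \<in> emb_sig P}"

abbreviation Rw :: "('s emb_trm \<times> 's emb_trm) set" where
  "Rw \<equiv> emb_rew P"

text \<open>Every left-hand side starts with some \<epsilon>, and its argument with a dotted
  constant. It displays all sorts of the right-hand side, hence determines it.\<close>

lemma orthogonal_emb_rew: "orthogonal (range (\<lambda>s. Cst (CEpsilon s))) Rw"
  unfolding orthogonal_def
proof (intro conjI allI impI)
  fix l r assume "(l, r) \<in> Rw"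
  then consider s1 s2 where "l = Epsilon s2 (Dot s1)" "r = U s1"
    | s1 s2 s3 where "l = Epsilon s3 (DotPi s1 s2 s3 (Var 1) (Var 0))"
        "r = Pi (Epsilon s1 (Var 1)) (Epsilon s2 (App (Var 1) (Var 0)))"
    by (auto simp: emb_rew_def)
  then show "(\<exists>e\<in>range (\<lambda>s. Cst (CEpsilon s)). \<exists>d. l = App (Atom e) (Atom d) \<and> (\<forall>\<sigma>. subst \<sigma> r = r)) \<or>
      (\<exists>e\<in>range (\<lambda>s. Cst (CEpsilon s)). \<exists>d. d \<notin> range (\<lambda>s. Cst (CEpsilon s)) \<and>
         l = App (Atom e) (App (App (Atom d) (Var 1)) (Var 0)) \<and>
         (\<forall>\<sigma> \<tau>. \<sigma> 0 = \<tau> 0 \<longrightarrow> \<sigma> 1 = \<tau> 1 \<longrightarrow> subst \<sigma> r = subst \<tau> r))"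
    by cases (auto simp: numeral_2_eq_2)
qed (auto simp: emb_rew_def)

sublocale LT: tsys "{Type, Kind}" "{(Type, Kind)}" "{(Type, Type, Type), (Type, Kind, Kind)}" emb_Sg Rw
    "range (\<lambda>s. Cst (CEpsilon s))"
proof unfold_locales
  show "orthogonal (range (\<lambda>s. Cst (CEpsilon s))) Rw" by (rule orthogonal_emb_rew)
next
  fix c A and \<sigma> :: "nat \<Rightarrow> 's emb_trm"
  assume "(c, A) \<in> emb_Sg"
  then show "subst \<sigma> A = A" by (auto simp: emb_Sg_def emb_sig_def arrow_def lift_def)
next
  fix c A A' assume "(c, A) \<in> emb_Sg" "(c, A') \<in> emb_Sg"
  then show "A = A'" using functional by (auto simp: emb_Sg_def emb_sig_def functional_def)
qed (auto simp: emb_Sg_def)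


subsection \<open>Typing in the \<open>\<lambda>\<Pi>\<close>-calculus modulo\<close>

lemma axms_srts: "(s1, s2) \<in> axms P \<Longrightarrow> s1 \<in> srts P \<and> s2 \<in> srts P"
  using is_pts by (auto simp: is_pts_def)

lemma ruls_srts: "(s1, s2, s3) \<in> ruls P \<Longrightarrow> s1 \<in> srts P \<and> s2 \<in> srts P \<and> s3 \<in> srts P"
  using is_pts by (auto simp: is_pts_def)

abbreviation DotPi_type :: "'s \<Rightarrow> 's \<Rightarrow> 's \<Rightarrow> 's emb_trm" where
  "DotPi_type s1 s2 s3 \<equiv> Pi (U s1) (Pi (Pi (Epsilon s1 (Var 0)) (U s2)) (U s3))"

lemma arrow_Atom: "arrow A (Atom a) = Pi A (Atom a)"
  by (simp add: arrow_def lift_def)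

lemma emb_Sg_simps [simp]:
  "(Cst (CU s), A) \<in> emb_Sg \<longleftrightarrow> s \<in> srts P \<and> A = Atom Type"
  "(Cst (CEpsilon s), A) \<in> emb_Sg \<longleftrightarrow> s \<in> srts P \<and> A = Pi (U s) (Atom Type)"
  "(Cst (CDot s), A) \<in> emb_Sg \<longleftrightarrow> (\<exists>s'. (s, s') \<in> axms P \<and> A = U s')"
  "(Cst (CDotPi s1 s2 s3), A) \<in> emb_Sg \<longleftrightarrow> (s1, s2, s3) \<in> ruls P \<and> A = DotPi_type s1 s2 s3"
  by (auto simp: emb_Sg_def emb_sig_def arrow_Atom)

lemma typed_Type: "LT.wfctx b \<Gamma> \<Longrightarrow> LT.typed b \<Gamma> (Atom Type) (Atom Kind)"
  by (rule LT.typ_sort) auto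

lemma typed_U: "LT.wfctx b \<Gamma> \<Longrightarrow> s \<in> srts P \<Longrightarrow> LT.typed b \<Gamma> (U s) (Atom Type)"
  by (rule LT.typ_const[where s = Kind]) (auto intro: typed_Type LT.wf_empty)

lemma typed_Pi:
  "LT.typed b \<Gamma> A (Atom Type) \<Longrightarrow> LT.typed b (A # \<Gamma>) B (Atom k) \<Longrightarrow> k \<in> {Type, Kind} \<Longrightarrow>
    LT.typed b \<Gamma> (Pi A B) (Atom k)"
  by (rule LT.typ_prod) auto

lemma typed_Lam:
  "LT.typed b \<Gamma> A (Atom Type) \<Longrightarrow> LT.typed b (A # \<Gamma>) B (Atom k) \<Longrightarrow> k \<in> {Type, Kind} \<Longrightarrow>
    LT.typed b (A # \<Gamma>) t B \<Longrightarrow> LT.typed b \<Gamma> (Lam A t) (Pi A B)"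
  by (rule LT.typ_abs) auto

lemma wfctx_Cons: "LT.typed b \<Gamma> A (Atom Type) \<Longrightarrow> LT.wfctx b (A # \<Gamma>)"
  by (rule LT.wf_decl) auto

lemma typed_Epsilon:
  assumes "LT.typed b \<Gamma> t (U s)" "s \<in> srts P"
  shows "LT.typed b \<Gamma> (Epsilon s t) (Atom Type)"
proof -
  have "LT.typed b [] (Pi (U s) (Atom Type)) (Atom Kind)"
    using assms(2) by (intro typed_Pi typed_U typed_Type wfctx_Cons LT.wf_empty) auto
  then have "LT.typed b \<Gamma> (Atom (Cst (CEpsilon s))) (Pi (U s) (Atom Type))"
    using assms by (intro LT.typ_const[where s = Kind] LT.typ_wf[OF assms(1)]) auto
  from LT.typ_app[OF this assms(1)] show ?thesis by (simp add: inst_eq)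
qed

lemma typed_Dot: "LT.wfctx b \<Gamma> \<Longrightarrow> (s1, s2) \<in> axms P \<Longrightarrow> LT.typed b \<Gamma> (Dot s1) (U s2)"
  by (rule LT.typ_const[where s = Type]) (auto intro: typed_U LT.wf_empty dest: axms_srts)

lemma typed_arrow_U:
  assumes "LT.typed b \<Gamma> A (Atom Type)" "s \<in> srts P"
  shows "LT.typed b \<Gamma> (Pi A (U s)) (Atom Type)"
  using assms by (intro typed_Pi typed_U wfctx_Cons) auto

lemma typed_DotPi_type:
  assumes "(s1, s2, s3) \<in> ruls P"
  shows "LT.typed b [] (DotPi_type s1 s2 s3) (Atom Type)"
proof -
  have s: "s1 \<in> srts P" "s2 \<in> srts P" "s3 \<in> srts P" using ruls_srts[OF assms] by auto
  have U1: "LT.typed b [] (U s1) (Atom Type)" using s by (intro typed_U LT.wf_empty)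
  have "LT.typed b [U s1] (Var 0) (U s1)" using LT.typ_var[OF wfctx_Cons[OF U1], of 0] by simp
  then show ?thesis using s U1 by (intro typed_Pi[OF U1] typed_arrow_U typed_Epsilon) auto
qed

lemma typed_DotPi_const:
  "LT.wfctx b \<Gamma> \<Longrightarrow> (s1, s2, s3) \<in> ruls P \<Longrightarrow>
    LT.typed b \<Gamma> (Atom (Cst (CDotPi s1 s2 s3))) (DotPi_type s1 s2 s3)"
  by (rule LT.typ_const[where s = Type]) (auto intro: typed_DotPi_type)

lemma typed_DotPi:
  assumes "LT.typed b \<Gamma> X (U s1)" "LT.typed b \<Gamma> Y (Pi (Epsilon s1 X) (U s2))" "(s1, s2, s3) \<in> ruls P"
  shows "LT.typed b \<Gamma> (DotPi s1 s2 s3 X Y) (U s3)"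
proof -
  have "LT.typed b \<Gamma> (App (Atom (Cst (CDotPi s1 s2 s3))) X) (Pi (Pi (Epsilon s1 X) (U s2)) (U s3))"
    using LT.typ_app[OF typed_DotPi_const[OF LT.typ_wf[OF assms(1)] assms(3)] assms(1)]
    by (simp add: inst_eq)
  from LT.typ_app[OF this assms(2)] show ?thesis by (simp add: inst_eq)
qed

lemma gen_Epsilon:
  assumes "LT.typed b \<Gamma> (Epsilon s t) T"
  shows "conv Rw (Atom Type) T"
proof -
  obtain A B where AB: "LT.typed b \<Gamma> (Atom (Cst (CEpsilon s))) (Pi A B)" "conv Rw (inst t B) T"
    using LT.gen_App[OF assms] by metis
  then have "conv Rw (Pi (U s) (Atom Type)) (Pi A B)"
    using LT.gen_Atom[OF AB(1)] by auto
  then have "conv Rw (inst t (Atom Type)) (inst t B)"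
    using Pi_injective[OF LT.orth] conv_inst conv_refl by metis
  then show ?thesis using AB(2) conv_trans by (simp add: inst_eq) blast
qed

lemma gen_DotPi_const:
  "LT.typed b \<Gamma> (Atom (Cst (CDotPi s1 s2 s3))) T \<Longrightarrow>
     (s1, s2, s3) \<in> ruls P \<and> conv Rw (DotPi_type s1 s2 s3) T"
  using LT.gen_Atom[of b \<Gamma> "Cst (CDotPi s1 s2 s3)" T] by auto

text \<open>The arguments receive their expected types themselves, not merely convertible ones:
  these types have type \<open>Type\<close>, so the conversions given by product injectivity can be
  applied.\<close>

lemma gen_DotPi:
  assumes "LT.typed False \<Gamma> (DotPi s1 s2 s3 X Y) T"
  shows "(s1, s2, s3) \<in> ruls P" "LT.typed False \<Gamma> X (U s1)"
    "LT.typed False \<Gamma> Y (Pi (Epsilon s1 X) (U s2))" "conv Rw (U s3) T"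
proof -
  have wf: "LT.wfctx False \<Gamma>" using LT.typ_wf[OF assms] .
  obtain A2 B2 where 1: "LT.typed False \<Gamma> (App (Atom (Cst (CDotPi s1 s2 s3))) X) (Pi A2 B2)"
    "LT.typed False \<Gamma> Y A2" "conv Rw (inst Y B2) T" using LT.gen_App[OF assms] .
  obtain A1 B1 where 2: "LT.typed False \<Gamma> (Atom (Cst (CDotPi s1 s2 s3))) (Pi A1 B1)"
    "LT.typed False \<Gamma> X A1" "conv Rw (inst X B1) (Pi A2 B2)" using LT.gen_App[OF 1(1)] .
  show r: "(s1, s2, s3) \<in> ruls P" using gen_DotPi_const[OF 2(1)] by blast
  then have s: "s1 \<in> srts P" "s2 \<in> srts P" "s3 \<in> srts P" using ruls_srts by blast+
  have c: "conv Rw (DotPi_type s1 s2 s3) (Pi A1 B1)" using gen_DotPi_const[OF 2(1)] by blast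
  then have "conv Rw A1 (U s1)" using Pi_injective[OF LT.orth] conv_sym by blast
  then show X: "LT.typed False \<Gamma> X (U s1)"
    using LT.typ_conv[OF 2(2) _ typed_U[OF wf s(1)]] by simp
  have "conv Rw (inst X (Pi (Pi (Epsilon s1 (Var 0)) (U s2)) (U s3))) (inst X B1)"
    using Pi_injective(2)[OF LT.orth c] by (simp add: conv_inst)
  then have c2: "conv Rw (Pi (Pi (Epsilon s1 X) (U s2)) (U s3)) (Pi A2 B2)"
    using 2(3) conv_trans by (simp add: inst_eq) blast
  then have "conv Rw A2 (Pi (Epsilon s1 X) (U s2))" using Pi_injective[OF LT.orth] conv_sym by blast
  then show "LT.typed False \<Gamma> Y (Pi (Epsilon s1 X) (U s2))"
    using LT.typ_conv[OF 1(2) _ typed_arrow_U[OF typed_Epsilon[OF X s(1)] s(2)]] by simp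
  have "conv Rw (inst Y (U s3)) (inst Y B2)" using Pi_injective(2)[OF LT.orth c2] by (simp add: conv_inst)
  then show "conv Rw (U s3) T" using 1(3) conv_trans by (simp add: inst_eq) blast
qed

text \<open>Both left-hand sides are \<epsilon>-terms, so their types are convertible to
  \<open>Type\<close>, and it suffices to type the right-hand sides by \<open>Type\<close>. The
  types of \<open>X\<close> and \<open>Y\<close> come from inverting the dotted product.\<close>

sublocale LT: tsys_rew "{Type, Kind}" "{(Type, Kind)}" "{(Type, Type, Type), (Type, Kind, Kind)}" emb_Sg Rw
    "range (\<lambda>s. Cst (CEpsilon s))"
proof unfold_locales
  fix l r \<Gamma> and \<sigma> :: "nat \<Rightarrow> 's emb_trm" and T
  assume lr: "(l, r) \<in> Rw" and l: "LT.typed False \<Gamma> (subst \<sigma> l) T"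
  from lr obtain s t where "l = Epsilon s t" by (auto simp: emb_rew_def)
  then have T: "conv Rw (Atom Type) T" "LT.valid False \<Gamma> T"
    using gen_Epsilon l LT.typ_valid[OF l] by auto
  have wf: "LT.wfctx False \<Gamma>" using LT.typ_wf[OF l] .
  from lr[unfolded emb_rew_def] have "LT.typed False \<Gamma> (subst \<sigma> r) (Atom Type)"
  proof (elim UnE CollectE exE conjE)
    fix s1 s2 assume "(l, r) = (Epsilon s2 (Dot s1), U s1)" "(s1, s2) \<in> axms P"
    then show ?thesis using typed_U[OF wf] axms_srts by simp
  next
    fix s1 s2 s3
    assume *: "(l, r) = (Epsilon s3 (DotPi s1 s2 s3 (Var 1) (Var 0)),
        Pi (Epsilon s1 (Var 1)) (Epsilon s2 (App (Var 1) (Var 0))))" "(s1, s2, s3) \<in> ruls P"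
    define X Y where "X = \<sigma> 1" "Y = \<sigma> 0"
    have "LT.typed False \<Gamma> (Epsilon s3 (DotPi s1 s2 s3 X Y)) T" using l * by (simp add: X_Y_def)
    then obtain T' where "LT.typed False \<Gamma> (DotPi s1 s2 s3 X Y) T'" by (rule LT.gen_App)
    note XY = gen_DotPi(2,3)[OF this]
    have s: "s1 \<in> srts P" "s2 \<in> srts P" using ruls_srts[OF *(2)] by auto
    have X: "LT.typed False \<Gamma> (Epsilon s1 X) (Atom Type)" using typed_Epsilon[OF XY(1) s(1)] .
    note wf' = wfctx_Cons[OF X]
    have "LT.typed False (Epsilon s1 X # \<Gamma>) (App (ren Suc Y) (Var 0)) (U s2)"
      using LT.typ_app[OF LT.weakening[OF XY(2) wf', simplified] LT.typ_var[OF wf', of 0, simplified]]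
      by (simp add: inst_eq)
    then have "LT.typed False \<Gamma> (Pi (Epsilon s1 X) (Epsilon s2 (App (ren Suc Y) (Var 0)))) (Atom Type)"
      using s by (intro typed_Pi[OF X] typed_Epsilon) auto
    then show ?thesis using * by (simp add: X_Y_def)
  qed
  then show "LT.typed False \<Gamma> (subst \<sigma> r) T" using T LT.typed_Atom_conv by blast
qed

lemma emb_typ_eq: "emb_typ P = LT.typed False"
proof -
  have "(lp_wf (emb_sig P) Rw \<Gamma> \<longrightarrow> LT.wfctx True \<Gamma>) \<and> (emb_typ P \<Delta> t T \<longrightarrow> LT.typed True \<Delta> t T)"
    for \<Gamma> \<Delta> t T
    by (rule lp_wf_lp_typ.induct)
      (use LT.wfctx_typed.intros[where b = True] in \<open>auto simp: ty_def emb_Sg_def\<close>)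
  moreover have "(LT.wfctx True \<Gamma> \<longrightarrow> lp_wf (emb_sig P) Rw \<Gamma>) \<and> (LT.typed True \<Delta> t T \<longrightarrow> emb_typ P \<Delta> t T)"
    for \<Gamma> \<Delta> t T
    apply (rule LT.wfctx_typed.induct)
    subgoal by (blast intro: lp_empty)
    subgoal by (blast intro: lp_decl)
    subgoal by (auto intro: lp_sort)
    subgoal by (auto simp: emb_Sg_def intro: lp_const)
    subgoal by (auto simp: ty_def intro: lp_var)
    subgoal by (auto intro: lp_prod)
    subgoal by (auto intro: lp_abs)
    subgoal by (blast intro: lp_app)
    subgoal by (blast intro: lp_conv)
    done
  ultimately show ?thesis unfolding LT.typ_False_eq by (intro ext) blast
qed


section \<open>The translation\<close>

abbreviation pt :: "'s trm list \<Rightarrow> 's trm \<Rightarrow> 's trm \<Rightarrow> bool" where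
  "pt \<equiv> PT.typed False"

abbreviation lt :: "'s emb_trm list \<Rightarrow> 's emb_trm \<Rightarrow> 's emb_trm \<Rightarrow> bool" where
  "lt \<equiv> LT.typed False"

abbreviation tr :: "'s trm list \<Rightarrow> 's trm \<Rightarrow> 's emb_trm" where
  "tr \<equiv> transl P"

section \<open>The translation under renaming, substitution and reduction\<close>

lemma sort_of_eq: "pt \<Gamma> A (Atom s) \<Longrightarrow> sort_of P \<Gamma> A = s"
  unfolding sort_of_def pts_typ_eq using PT.sort_unique by blast

lemma transl_Pi:
  assumes "pt \<Gamma> A (Atom s1)" "pt (A # \<Gamma>) B (Atom s2)" "(s1, s2, s3) \<in> ruls P"
  shows "tr \<Gamma> (Pi A B) = DotPi s1 s2 s3 (tr \<Gamma> A) (Lam (Epsilon s1 (tr \<Gamma> A)) (tr (A # \<Gamma>) B))"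
  using assms sort_of_eq[OF PT.typ_prod[OF assms]] by (simp add: sort_of_eq)

lemma transl_Lam:
  assumes "pt \<Gamma> A (Atom s1)"
  shows "tr \<Gamma> (Lam A t) = Lam (Epsilon s1 (tr \<Gamma> A)) (tr (A # \<Gamma>) t)"
  using assms by (simp add: sort_of_eq)

declare transl.simps(3,4) [simp del]

lemma transl_ren:
  "pt \<Gamma> t T \<Longrightarrow> PT.ren_ok False \<Gamma> \<Delta> f \<Longrightarrow> tr \<Delta> (ren f t) = ren f (tr \<Gamma> t)"
proof (induction t arbitrary: \<Gamma> \<Delta> f T)
  case (Pi A B)
  obtain s1 s2 s3 where *: "pt \<Gamma> A (Atom s1)" "pt (A # \<Gamma>) B (Atom s2)" "(s1, s2, s3) \<in> ruls P"
    using PT.gen_Pi[OF Pi.prems(1)] by metis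
  have A: "pt \<Delta> (ren f A) (Atom s1)" using PT.typ_ren[OF *(1) Pi.prems(2)] by simp
  then have ok: "PT.ren_ok False (A # \<Gamma>) (ren f A # \<Delta>) (up_ren f)"
    by (intro PT.ren_ok_up[OF Pi.prems(2)] PT.wf_decl) auto
  then have B: "pt (ren f A # \<Delta>) (ren (up_ren f) B) (Atom s2)" using PT.typ_ren[OF *(2)] by fastforce
  show ?case using Pi.IH(1)[OF *(1) Pi.prems(2)] Pi.IH(2)[OF *(2) ok]
    by (simp add: transl_Pi[OF A B *(3)] transl_Pi[OF *])
next
  case (Lam A t)
  obtain s1 B where *: "pt \<Gamma> A (Atom s1)" "pt (A # \<Gamma>) t B"
    using PT.gen_Lam[OF Lam.prems(1)] by metis
  have A: "pt \<Delta> (ren f A) (Atom s1)" using PT.typ_ren[OF *(1) Lam.prems(2)] by simp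
  then have ok: "PT.ren_ok False (A # \<Gamma>) (ren f A # \<Delta>) (up_ren f)"
    by (intro PT.ren_ok_up[OF Lam.prems(2)] PT.wf_decl) auto
  show ?case using Lam.IH(1)[OF *(1) Lam.prems(2)] Lam.IH(2)[OF *(2) ok]
    by (simp add: transl_Lam[OF A] transl_Lam[OF *(1)])
next
  case (App t u)
  then show ?case by (metis PT.gen_App transl.simps(5) ren.simps(5))
qed simp_all

text \<open>The translation reads sorts off the context, so typing is needed to know that they
  survive. \<open>\<tau>\<close> is constrained on declared indices only: elsewhere
  \<open>\<sigma> i\<close> need not be typable, and \<open>transl_ren\<close> would fail under a
  binder.\<close>

lemma transl_subst:
  "pt \<Gamma> t T \<Longrightarrow> PT.sub_ok False \<Gamma> \<Delta> \<sigma> \<Longrightarrow> (\<And>i. i < length \<Gamma> \<Longrightarrow> \<tau> i = tr \<Delta> (\<sigma> i)) \<Longrightarrow>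
    tr \<Delta> (subst \<sigma> t) = subst \<tau> (tr \<Gamma> t)"
proof (induction t arbitrary: \<Gamma> \<Delta> \<sigma> \<tau> T)
  case (Var i)
  then show ?case using PT.gen_Var by fastforce
next
  case (Pi A B)
  obtain s1 s2 s3 where *: "pt \<Gamma> A (Atom s1)" "pt (A # \<Gamma>) B (Atom s2)" "(s1, s2, s3) \<in> ruls P"
    using PT.gen_Pi[OF Pi.prems(1)] by metis
  have A: "pt \<Delta> (subst \<sigma> A) (Atom s1)" using PT.typ_subst[OF *(1) Pi.prems(2)] by simp
  then have wf: "PT.wfctx False (subst \<sigma> A # \<Delta>)" by (rule PT.wf_decl) simp
  then have ok: "PT.sub_ok False (A # \<Gamma>) (subst \<sigma> A # \<Delta>) (up_subst \<sigma>)"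
    by (intro PT.sub_ok_up[OF Pi.prems(2)])
  then have B: "pt (subst \<sigma> A # \<Delta>) (subst (up_subst \<sigma>) B) (Atom s2)" using PT.typ_subst[OF *(2)] by fastforce
  have "up_subst \<tau> i = tr (subst \<sigma> A # \<Delta>) (up_subst \<sigma> i)" if "i < length (A # \<Gamma>)" for i
    using that Pi.prems(2,3) transl_ren[OF _ PT.ren_ok_Suc[OF wf]]
    by (cases i) (auto simp: PT.sub_ok_def)
  from Pi.IH(2)[OF *(2) ok this] show ?case using Pi.IH(1)[OF *(1) Pi.prems(2,3)]
    by (simp add: transl_Pi[OF A B *(3)] transl_Pi[OF *])
next
  case (Lam A t)
  obtain s1 B where *: "pt \<Gamma> A (Atom s1)" "pt (A # \<Gamma>) t B"
    using PT.gen_Lam[OF Lam.prems(1)] by metis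
  have A: "pt \<Delta> (subst \<sigma> A) (Atom s1)" using PT.typ_subst[OF *(1) Lam.prems(2)] by simp
  then have wf: "PT.wfctx False (subst \<sigma> A # \<Delta>)" by (rule PT.wf_decl) simp
  then have ok: "PT.sub_ok False (A # \<Gamma>) (subst \<sigma> A # \<Delta>) (up_subst \<sigma>)"
    by (intro PT.sub_ok_up[OF Lam.prems(2)])
  have "up_subst \<tau> i = tr (subst \<sigma> A # \<Delta>) (up_subst \<sigma> i)" if "i < length (A # \<Gamma>)" for i
    using that Lam.prems(2,3) transl_ren[OF _ PT.ren_ok_Suc[OF wf]]
    by (cases i) (auto simp: PT.sub_ok_def)
  from Lam.IH(2)[OF *(2) ok this] show ?case using Lam.IH(1)[OF *(1) Lam.prems(2,3)]
    by (simp add: transl_Lam[OF A] transl_Lam[OF *(1)])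
next
  case (App t u)
  obtain A B where "pt \<Gamma> t (Pi A B)" "pt \<Gamma> u A" using PT.gen_App[OF App.prems(1)] by metis
  then show ?case using App by (metis transl.simps(5) subst.simps(5))
qed simp_all

lemma transl_inst:
  assumes "pt (A # \<Gamma>) t T" "pt \<Gamma> u A"
  shows "tr \<Gamma> (inst u t) = inst (tr \<Gamma> u) (tr (A # \<Gamma>) t)"
  unfolding inst_eq
  by (rule transl_subst[OF assms(1) PT.sub_ok_inst[OF assms(2)]]) (simp split: nat.split)

lemma transl_context_conv:
  assumes "pt (A # \<Gamma>) t T" "conv {} A A'" "pt \<Gamma> A (Atom s)" "pt \<Gamma> A' (Atom s)"
  shows "tr (A' # \<Gamma>) t = tr (A # \<Gamma>) t"
  using transl_subst[OF assms(1) PT.sub_ok_context_conv[OF PT.typ_wf[OF assms(1)]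
      conv_sym[OF assms(2)] assms(3,4)], of Var] by simp

text \<open>Stated with conversion because a step in the domain of a product has to be repeated: the
  translated domain also annotates the abstraction in the second argument.\<close>

lemma transl_red: "pt \<Gamma> t T \<Longrightarrow> red {} t t' \<Longrightarrow> conv Rw (tr \<Gamma> t) (tr \<Gamma> t')"
proof (induction t arbitrary: \<Gamma> T t')
  case (Pi A B)
  obtain s1 s2 s3 where *: "pt \<Gamma> A (Atom s1)" "pt (A # \<Gamma>) B (Atom s2)" "(s1, s2, s3) \<in> ruls P"
    using PT.gen_Pi[OF Pi.prems(1)] by metis
  from Pi.prems(2) show ?case
  proof (rule PT.red_Pi)
    fix A' assume t': "t' = Pi A' B" and A': "red {} A A'"
    have A'_typ: "pt \<Gamma> A' (Atom s1)" using PT.subject_reduction[OF *(1) A'] .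
    note B = PT.typ_context_conv[OF *(2) red_conv[OF A'] *(1) A'_typ UNIV_I]
    show ?thesis using Pi.IH(1)[OF *(1) A'] transl_context_conv[OF *(2) red_conv[OF A'] *(1) A'_typ]
      unfolding t' transl_Pi[OF *] transl_Pi[OF A'_typ B *(3)]
      by (intro conv_App conv_Lam) simp_all
  next
    fix B' assume t': "t' = Pi A B'" and B': "red {} B B'"
    show ?thesis using Pi.IH(2)[OF *(2) B']
      unfolding t' transl_Pi[OF *] transl_Pi[OF *(1) PT.subject_reduction[OF *(2) B'] *(3)]
      by (intro conv_App conv_Lam) simp_all
  qed
next
  case (Lam A t)
  obtain s1 B where *: "pt \<Gamma> A (Atom s1)" "pt (A # \<Gamma>) t B"
    using PT.gen_Lam[OF Lam.prems(1)] by metis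
  from Lam.prems(2) show ?case
  proof (rule PT.red_Lam)
    fix A' assume t': "t' = Lam A' t" and A': "red {} A A'"
    have A'_typ: "pt \<Gamma> A' (Atom s1)" using PT.subject_reduction[OF *(1) A'] .
    show ?thesis using Lam.IH(1)[OF *(1) A'] transl_context_conv[OF *(2) red_conv[OF A'] *(1) A'_typ]
      unfolding t' transl_Lam[OF *(1)] transl_Lam[OF A'_typ]
      by (intro conv_App conv_Lam) simp_all
  next
    fix u assume t': "t' = Lam A u" and u: "red {} t u"
    show ?thesis using Lam.IH(2)[OF *(2) u]
      unfolding t' transl_Lam[OF *(1)] by (intro conv_Lam) simp_all
  qed
next
  case (App t u)
  obtain A B where *: "pt \<Gamma> t (Pi A B)" "pt \<Gamma> u A" using PT.gen_App[OF App.prems(1)] by metis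
  from App.prems(2) show ?case
  proof (rule red_AppE)
    fix A0 t0 assume t': "t' = inst u t0" and t: "t = Lam A0 t0"
    obtain s1 B0 where 1: "pt \<Gamma> A0 (Atom s1)" "pt (A0 # \<Gamma>) t0 B0" "conv {} (Pi A0 B0) (Pi A B)"
      using PT.gen_Lam[OF *(1)[unfolded t]] by metis
    have "pt \<Gamma> u A0"
      using PT.typ_conv[OF *(2) _ 1(1)] Pi_injective[OF PT.orth 1(3)] conv_sym by blast
    then show ?thesis
      unfolding t t' using transl_inst[OF 1(2)] by (simp add: transl_Lam[OF 1(1)] conv_beta)
  next
    fix v assume "t' = App v u" "red {} t v"
    then show ?thesis using App.IH(1)[OF *(1)] by (simp add: conv_App)
  next
    fix v assume "t' = App t v" "red {} u v"
    then show ?thesis using App.IH(2)[OF *(2)] by (simp add: conv_App)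
  qed simp
qed (simp_all add: PT.not_red_Var PT.not_red_Atom)

lemma transl_reds: "(red {})\<^sup>*\<^sup>* t t' \<Longrightarrow> pt \<Gamma> t T \<Longrightarrow> conv Rw (tr \<Gamma> t) (tr \<Gamma> t')"
proof (induction rule: rtranclp_induct)
  case (step u v)
  then show ?case using transl_red PT.subject_reductions conv_trans by blast
qed simp

lemma transl_conv:
  assumes "pt \<Gamma> A T" "pt \<Gamma> B T'" "conv {} A B"
  shows "conv Rw (tr \<Gamma> A) (tr \<Gamma> B)"
proof -
  obtain C where "(red {})\<^sup>*\<^sup>* A C" "(red {})\<^sup>*\<^sup>* B C" using conv_common_reduct[OF PT.orth assms(3)] .
  then show ?thesis using transl_reds assms(1,2) conv_sym conv_trans by blast
qed


subsection \<open>Translation of types\<close>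

abbreviation tt :: "'s trm list \<Rightarrow> 's trm \<Rightarrow> 's emb_trm" where
  "tt \<Gamma> A \<equiv> the (transl_type P \<Gamma> A)"

lemma transl_type_typed:
  "pt \<Gamma> A (Atom s) \<Longrightarrow> transl_type P \<Gamma> A = Some (Epsilon s (tr \<Gamma> A))"
  by (auto simp: transl_type_def pts_typ_eq sort_of_eq)

lemma tt_typed: "pt \<Gamma> A (Atom s) \<Longrightarrow> tt \<Gamma> A = Epsilon s (tr \<Gamma> A)"
  by (simp add: transl_type_typed)

primrec tctx :: "'s trm list \<Rightarrow> 's emb_trm list" where
  "tctx [] = []"
| "tctx (A # \<Gamma>) = tt \<Gamma> A # tctx \<Gamma>"

lemma length_tctx [simp]: "length (tctx \<Gamma>) = length \<Gamma>"
  by (induction \<Gamma>) simp_all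

lemma typed_axm: "pt \<Gamma> (Atom s) T \<Longrightarrow> \<exists>s'. (s, s') \<in> axms P \<and> pt \<Gamma> (Atom s) (Atom s')"
  using PT.gen_Atom[of False \<Gamma> s T] PT.typ_wf[of False \<Gamma> "Atom s" T] PT.typ_sort[of False \<Gamma> s] by auto

lemma sort_in_srts: "pt \<Gamma> A (Atom s) \<Longrightarrow> s \<in> srts P"
  using PT.typ_valid[of False \<Gamma> A "Atom s"] typed_axm[of \<Gamma> s] axms_srts ruls_srts
  by (auto simp: PT.valid_def)

lemma transl_type_cases:
  assumes "transl_type P \<Gamma> A = Some T"
  obtains s where "pt \<Gamma> A (Atom s)" "T = Epsilon s (tr \<Gamma> A)"
  | s where "A = Atom s" "s \<in> srts P" "\<nexists>B. pt \<Gamma> A B" "T = U s"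
proof (cases "\<exists>s. pt \<Gamma> A (Atom s)")
  case True
  then show ?thesis using that(1) assms transl_type_typed by fastforce
next
  case False
  then show ?thesis using that(2) assms
    by (auto simp: transl_type_def pts_typ_eq split: trm.splits if_splits)
qed

text \<open>A typable sort translates to an \<epsilon>-term and an untypable one to
  \<open>U s\<close>. The first family of rewrite rules removes the difference up to
  conversion.\<close>

lemma transl_type_Atom:
  assumes "s \<in> srts P"
  shows "\<exists>T. transl_type P \<Gamma> (Atom s) = Some T \<and> conv Rw T (U s)"
proof (cases "\<exists>B. pt \<Gamma> (Atom s) B")
  case True
  then obtain s' where s': "(s, s') \<in> axms P" "pt \<Gamma> (Atom s) (Atom s')" using typed_axm by blast
  then have "(Epsilon s' (Dot s), U s) \<in> Rw" by (auto simp: emb_rew_def)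
  from red.rewrite[OF this, of Var] have "conv Rw (Epsilon s' (Dot s)) (U s)" by (simp add: red_conv)
  then show ?thesis using transl_type_typed[OF s'(2)] by simp
next
  case False
  then show ?thesis using assms by (auto simp: transl_type_def pts_typ_eq)
qed

lemma transl_type_valid:
  assumes "PT.valid False \<Gamma> A"
  shows "\<exists>T. transl_type P \<Gamma> A = Some T"
proof (cases "\<exists>s. pt \<Gamma> A (Atom s)")
  case True
  then show ?thesis using transl_type_typed by blast
next
  case False
  then obtain s where "A = Atom s" "s \<in> srts P"
    using assms axms_srts ruls_srts by (auto simp: PT.valid_def)
  then show ?thesis using transl_type_Atom by blast
qed

lemma tctx_ty: "PT.wfctx False \<Gamma> \<Longrightarrow> i < length \<Gamma> \<Longrightarrow> ty (tctx \<Gamma>) i = tt \<Gamma> (ty \<Gamma> i)"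
proof (induction \<Gamma> arbitrary: i)
  case (Cons A \<Gamma>)
  obtain s where s: "pt \<Gamma> A (Atom s)" using PT.wf_ConsD[OF Cons.prems(1)] by blast
  note up = PT.ren_ok_Suc[OF Cons.prems(1)]
  have *: "tt (A # \<Gamma>) (ren Suc B) = ren Suc (tt \<Gamma> B)" if "pt \<Gamma> B (Atom k)" for B k
    using tt_typed[OF that] tt_typed[of "A # \<Gamma>" "ren Suc B" k] PT.typ_ren[OF that up]
      transl_ren[OF that up] by simp
  show ?case
  proof (cases i)
    case 0
    then show ?thesis using *[OF s] by simp
  next
    case (Suc j)
    have wf: "PT.wfctx False \<Gamma>" using PT.typ_wf[OF s] .
    then obtain k where "pt \<Gamma> (ty \<Gamma> j) (Atom k)" using PT.typ_ty[OF wf] Cons.prems Suc by auto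
    then show ?thesis using Cons.IH[OF wf, of j] Cons.prems Suc * by simp
  qed
qed simp

text \<open>The rewrite rule leaves the redex (\<lambda>x. Y) x in the codomain. Contracting it
  undoes the lifting of the abstraction under the new binder.\<close>

lemma reds_Epsilon_DotPi:
  assumes "(s1, s2, s3) \<in> ruls P"
  shows "(red Rw)\<^sup>*\<^sup>* (Epsilon s3 (DotPi s1 s2 s3 X (Lam C Y))) (Pi (Epsilon s1 X) (Epsilon s2 Y))"
proof -
  have "(Epsilon s3 (DotPi s1 s2 s3 (Var 1) (Var 0)),
      Pi (Epsilon s1 (Var 1)) (Epsilon s2 (App (Var 1) (Var 0)))) \<in> Rw"
    using assms by (auto simp: emb_rew_def)
  from red.rewrite[OF this, of "case_nat (Lam C Y) (\<lambda>_. X)"]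
  have "red Rw (Epsilon s3 (DotPi s1 s2 s3 X (Lam C Y)))
      (Pi (Epsilon s1 X) (Epsilon s2 (App (Lam (ren Suc C) (ren (up_ren Suc) Y)) (Var 0))))"
    by simp
  moreover have "red Rw (Pi (Epsilon s1 X) (Epsilon s2 (App (Lam (ren Suc C) (ren (up_ren Suc) Y)) (Var 0))))
      (Pi (Epsilon s1 X) (Epsilon s2 Y))"
    by (metis red.Pi_right red.App_right red.beta inst_Var_up_ren)
  ultimately show ?thesis by (meson r_into_rtranclp rtranclp_trans)
qed

lemma reds_tt_Pi:
  assumes "pt \<Gamma> A (Atom s1)" "pt (A # \<Gamma>) B (Atom s2)" "(s1, s2, s3) \<in> ruls P"
  shows "(red Rw)\<^sup>*\<^sup>* (tt \<Gamma> (Pi A B)) (Pi (tt \<Gamma> A) (tt (A # \<Gamma>) B))"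
  using reds_Epsilon_DotPi[OF assms(3)] tt_typed[OF PT.typ_prod[OF assms]]
  by (simp add: tt_typed[OF assms(1)] tt_typed[OF assms(2)] transl_Pi[OF assms])

lemma tt_conv:
  assumes "pt \<Gamma> A (Atom s)" "pt \<Gamma> B (Atom s)" "conv {} A B"
  shows "conv Rw (tt \<Gamma> A) (tt \<Gamma> B)"
  using transl_conv[OF assms] by (simp add: tt_typed[OF assms(1)] tt_typed[OF assms(2)] conv_App)

lemma conv_tt_Atom: "s \<in> srts P \<Longrightarrow> conv Rw (tt \<Gamma> (Atom s)) (U s)"
  using transl_type_Atom[of s \<Gamma>] by auto


subsection \<open>Soundness\<close>

lemma typed_tt_Atom:
  assumes "LT.wfctx False \<Delta>" "s \<in> srts P"
  shows "lt \<Delta> (tt \<Gamma> (Atom s)) (Atom Type)"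
proof (cases "\<exists>B. pt \<Gamma> (Atom s) B")
  case True
  then obtain s' where "(s, s') \<in> axms P" "pt \<Gamma> (Atom s) (Atom s')" using typed_axm by blast
  then show ?thesis using assms axms_srts tt_typed typed_Epsilon[OF typed_Dot] by simp
next
  case False
  then have "tt \<Gamma> (Atom s) = U s" using assms by (auto simp: transl_type_def pts_typ_eq)
  then show ?thesis using assms typed_U by simp
qed

lemma typed_tt_iff:
  assumes "s \<in> srts P" "LT.wfctx False \<Delta>"
  shows "lt \<Delta> t (tt \<Gamma> (Atom s)) \<longleftrightarrow> lt \<Delta> t (U s)"
  using LT.typ_conv[OF _ conv_tt_Atom[OF assms(1)] typed_U[OF assms(2,1)]]
    LT.typ_conv[OF _ conv_sym[OF conv_tt_Atom[OF assms(1)]] typed_tt_Atom[OF assms(2,1)]]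
  by auto

lemma typed_U_tt:
  assumes "pt \<Gamma> A (Atom s)" "lt \<Delta> (tr \<Gamma> A) (tt \<Gamma> (Atom s))"
  shows "lt \<Delta> (tr \<Gamma> A) (U s)" "lt \<Delta> (tt \<Gamma> A) (Atom Type)"
proof -
  have s: "s \<in> srts P" using sort_in_srts[OF assms(1)] .
  show "lt \<Delta> (tr \<Gamma> A) (U s)" using assms(2) typed_tt_iff[OF s LT.typ_wf[OF assms(2)]] by simp
  then show "lt \<Delta> (tt \<Gamma> A) (Atom Type)" using typed_Epsilon[OF _ s] by (simp add: tt_typed[OF assms(1)])
qed

text \<open>The induction runs over strict derivations because their conversion case supplies a
  common sort for both types, as \<open>tt_conv\<close> requires.\<close>

lemma soundness_strict:
  "(PT.wfctx True \<Gamma>0 \<longrightarrow> LT.wfctx False (tctx \<Gamma>0)) \<and>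
   (PT.typed True \<Gamma> t A \<longrightarrow> lt (tctx \<Gamma>) (tr \<Gamma> t) (tt \<Gamma> A))"
proof (rule PT.wfctx_typed.induct, goal_cases)
  case 1
  show ?case by (simp add: LT.wf_empty)
next
  case (2 \<Gamma> A s)
  then show ?case using typed_U_tt(2)[OF PT.strict_imp_relaxed] wfctx_Cons by simp
next
  case (3 \<Gamma> s1 s2)
  then show ?case using typed_tt_iff[of s2 "tctx \<Gamma>"] typed_Dot axms_srts by simp
next
  case (4 \<Gamma> c A s)
  then show ?case by simp
next
  case (5 \<Gamma> i)
  have "PT.wfctx False \<Gamma>"
    using PT.typ_var[OF 5(1) 5(3)] PT.strict_imp_relaxed PT.typ_wf by blast
  then show ?case using 5 LT.typ_var[OF 5(2), of i] tctx_ty by simp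
next
  case (6 \<Gamma> A s1 B s2 s3)
  note hyp = 6(1,3)[THEN PT.strict_imp_relaxed]
  note A = typed_U_tt[OF hyp(1) 6(2)] and B = typed_U_tt[OF hyp(2) 6(4)]
  have s: "s1 \<in> srts P" "s2 \<in> srts P" "s3 \<in> srts P" using ruls_srts[OF 6(5)] by auto
  have wf: "LT.wfctx False (tt \<Gamma> A # tctx \<Gamma>)" using wfctx_Cons[OF A(2)] .
  have "lt (tctx \<Gamma>) (Lam (tt \<Gamma> A) (tr (A # \<Gamma>) B)) (Pi (tt \<Gamma> A) (U s2))"
    using typed_Lam[OF A(2) typed_U[OF wf s(2)]] B(1) by simp
  then have "lt (tctx \<Gamma>) (tr \<Gamma> (Pi A B)) (U s3)"
    using typed_DotPi[OF A(1) _ 6(5)] by (simp add: transl_Pi[OF hyp 6(5)] tt_typed[OF hyp(1)])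
  then show ?case using typed_tt_iff[OF s(3)] LT.typ_wf by blast
next
  case (7 \<Gamma> A s1 B s2 t s3)
  note hyp = 7(1,3)[THEN PT.strict_imp_relaxed]
  note A = typed_U_tt[OF hyp(1) 7(2)] and B = typed_U_tt[OF hyp(2) 7(4)]
  have s: "s1 \<in> srts P" "s2 \<in> srts P" "s3 \<in> srts P" using ruls_srts[OF 7(7)] by auto
  have wf: "LT.wfctx False (tt \<Gamma> A # tctx \<Gamma>)" using wfctx_Cons[OF A(2)] .
  have "lt (tctx \<Gamma>) (Lam (tt \<Gamma> A) (tr (A # \<Gamma>) B)) (Pi (tt \<Gamma> A) (U s2))"
    using typed_Lam[OF A(2) typed_U[OF wf s(2)]] B(1) by simp
  then have "lt (tctx \<Gamma>) (tr \<Gamma> (Pi A B)) (U s3)"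
    using typed_DotPi[OF A(1) _ 7(7)] by (simp add: transl_Pi[OF hyp 7(7)] tt_typed[OF hyp(1)])
  then have Pi: "lt (tctx \<Gamma>) (tt \<Gamma> (Pi A B)) (Atom Type)"
    using typed_Epsilon[OF _ s(3)] by (simp add: tt_typed[OF PT.typ_prod[OF hyp 7(7)]])
  have "lt (tctx \<Gamma>) (tr \<Gamma> (Lam A t)) (Pi (tt \<Gamma> A) (tt (A # \<Gamma>) B))"
    using typed_Lam[OF A(2)] B(2) 7(6) by (simp add: transl_Lam[OF hyp(1)] tt_typed[OF hyp(1)])
  then show ?case
    using LT.typ_conv[OF _ conv_sym[OF reds_conv[OF reds_tt_Pi[OF hyp 7(7)]]] Pi] by simp
next
  case (8 \<Gamma> t A B u)
  note hyp = 8(1,3)[THEN PT.strict_imp_relaxed]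
  obtain s where "pt \<Gamma> (Pi A B) (Atom s)" using PT.typ_valid[OF hyp(1)] PT.valid_Pi by blast
  then obtain s1 s2 s3 where 1: "pt \<Gamma> A (Atom s1)" "pt (A # \<Gamma>) B (Atom s2)" "(s1, s2, s3) \<in> ruls P"
    by (rule PT.gen_Pi)
  \<comment> \<open>The translated function type is an \<epsilon>-term that only reduces to a
    product; subject reduction gives that product the sort needed for the conversion.\<close>
  note reds = reds_tt_Pi[OF 1]
  have "LT.valid False (tctx \<Gamma>) (tt \<Gamma> (Pi A B))" using LT.typ_valid[OF 8(2)] .
  then obtain k where "k \<in> {Type, Kind}" "lt (tctx \<Gamma>) (tt \<Gamma> (Pi A B)) (Atom k)"
    unfolding LT.valid_def using tt_typed[OF PT.typ_prod[OF 1]] by auto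
  then have "lt (tctx \<Gamma>) (tr \<Gamma> t) (Pi (tt \<Gamma> A) (tt (A # \<Gamma>) B))"
    using LT.typ_conv[OF 8(2) reds_conv[OF reds]] LT.subject_reductions[OF reds] by blast
  then have "lt (tctx \<Gamma>) (App (tr \<Gamma> t) (tr \<Gamma> u)) (inst (tr \<Gamma> u) (tt (A # \<Gamma>) B))"
    using 8(4) LT.typ_app by blast
  moreover have "pt \<Gamma> (inst u B) (Atom s2)"
    using PT.typ_inst[OF 1(2) hyp(2)] by (simp add: inst_eq)
  then have "inst (tr \<Gamma> u) (tt (A # \<Gamma>) B) = tt \<Gamma> (inst u B)"
    using transl_inst[OF 1(2) hyp(2)] by (simp add: tt_typed[OF 1(2)] tt_typed inst_eq)
  ultimately show ?case by simp
next
  case (9 \<Gamma> t A B s)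
  have A: "pt \<Gamma> A (Atom s)" and B: "pt \<Gamma> B (Atom s)" using 9 PT.strict_imp_relaxed by blast+
  show ?case using LT.typ_conv[OF 9(2) tt_conv[OF A B 9(3)] typed_U_tt(2)[OF B 9(5)]] by simp
qed

lemma soundness: "pt \<Gamma> t A \<Longrightarrow> lt (tctx \<Gamma>) (tr \<Gamma> t) (tt \<Gamma> A)"
  using soundness_strict PT.relaxed_imp_strict by blast

lemma wf_tctx: "PT.wfctx False \<Gamma> \<Longrightarrow> LT.wfctx False (tctx \<Gamma>)"
proof (cases \<Gamma>)
  case (Cons A \<Delta>)
  assume "PT.wfctx False \<Gamma>"
  then obtain s where A: "pt \<Delta> A (Atom s)" using PT.wf_ConsD Cons by blast
  then show ?thesis using typed_U_tt(2)[OF A soundness[OF A]] wfctx_Cons by (simp add: Cons)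
qed (simp add: LT.wf_empty)

lemma typed_tt: "pt \<Gamma> A (Atom s) \<Longrightarrow> lt (tctx \<Gamma>) (tt \<Gamma> A) (Atom Type)"
  using typed_U_tt(2) soundness by blast


subsection \<open>The inverse translation\<close>

text \<open>The images need not be typable in \<open>P\<close>; they enter only into untyped
  \<beta>-conversion.\<close>

primrec bt_const :: "'s emb_const \<Rightarrow> 's trm" where
  "bt_const (CU s) = Atom s"
| "bt_const (CDot s) = Atom s"
| "bt_const (CEpsilon s) = Lam (Atom s) (Var 0)"
| "bt_const (CDotPi s1 s2 s3) =
     Lam (Atom s1) (Lam (Pi (Var 0) (Atom s2)) (Pi (Var 1) (App (Var 1) (Var 0))))"

text \<open>The value at \<open>Type\<close> and \<open>Kind\<close> is a default: neither occurs in
  the rewrite rules or in translated terms.\<close>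

primrec bt_atom :: "'s emb_const lp_atom \<Rightarrow> 's trm" where
  "bt_atom Type = Atom undefined"
| "bt_atom Kind = Atom undefined"
| "bt_atom (Cst c) = bt_const c"

abbreviation bt :: "'s emb_trm \<Rightarrow> 's trm" where
  "bt \<equiv> asub bt_atom"

lemma closed_bt_atom: "subst \<sigma> (bt_atom a) = bt_atom a"
proof (cases a)
  case (Cst c)
  then show ?thesis by (cases c) simp_all
qed simp_all

lemma conv_id: "conv {} (App (Lam A (Var 0)) t) t"
  using conv_beta[of "{}" A "Var 0" t] by (simp add: inst_eq)

lemma bt_DotPi: "conv {} (bt (DotPi s1 s2 s3 X Y)) (Pi (bt X) (App (ren Suc (bt Y)) (Var 0)))"
proof -
  let ?X = "bt X" and ?Y = "bt Y"
  have "conv {} (App (bt_const (CDotPi s1 s2 s3)) ?X)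
      (Lam (Pi ?X (Atom s2)) (Pi (ren Suc ?X) (App (Var 1) (Var 0))))"
    using conv_beta[of "{}" "Atom s1" "Lam (Pi (Var 0) (Atom s2)) (Pi (Var 1) (App (Var 1) (Var 0)))" ?X]
    by (simp add: inst_eq)
  then have "conv {} (bt (DotPi s1 s2 s3 X Y))
      (App (Lam (Pi ?X (Atom s2)) (Pi (ren Suc ?X) (App (Var 1) (Var 0)))) ?Y)"
    by (simp add: conv_App)
  also have "conv {} \<dots> (inst ?Y (Pi (ren Suc ?X) (App (Var 1) (Var 0))))" by (rule conv_beta)
  also have "inst ?Y (Pi (ren Suc ?X) (App (Var 1) (Var 0))) = Pi ?X (App (ren Suc ?Y) (Var 0))"
    using inst_lift[of ?Y ?X] by (simp add: inst_eq)
  finally show ?thesis .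
qed

text \<open>With \<epsilon> the identity, both sides of a rule become \<beta>-convertible: to a sort
  in the first family, to \<Pi>x:X. Y x in the second.\<close>

lemma bt_conv: "conv Rw t u \<Longrightarrow> conv {} (bt t) (bt u)"
proof (rule asub_conv[OF closed_bt_atom])
  fix l r and \<sigma> :: "nat \<Rightarrow> 's trm" assume "(l, r) \<in> Rw"
  then consider s1 s2 where "l = Epsilon s2 (Dot s1)" "r = U s1"
    | s1 s2 s3 where "l = Epsilon s3 (DotPi s1 s2 s3 (Var 1) (Var 0))"
        "r = Pi (Epsilon s1 (Var 1)) (Epsilon s2 (App (Var 1) (Var 0)))"
    by (auto simp: emb_rew_def)
  then have "conv {} (bt l) (bt r)"
  proof cases
    case 2
    have "conv {} (bt l) (bt (DotPi s1 s2 s3 (Var 1) (Var 0)))" using conv_id by (simp add: 2)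
    also have "conv {} \<dots> (Pi (Var 1) (App (Var 1) (Var 0)))"
      using bt_DotPi[of s1 s2 s3 "Var 1" "Var 0"] by simp
    also have "conv {} \<dots> (bt r)" by (simp add: 2 conv_Pi conv_id conv_sym)
    finally show ?thesis .
  qed (simp add: conv_id)
  then show "conv {} (subst \<sigma> (bt l)) (subst \<sigma> (bt r))" by (rule conv_subst)
qed

lemma bt_Epsilon: "conv {} (bt (Epsilon s t)) (bt t)"
  by (simp add: conv_id)

text \<open>True of ill-typed terms as well: whatever \<open>sort_of\<close> returns ends up in
  annotations that \<beta> discards.\<close>

lemma bt_transl: "conv {} (bt (tr \<Gamma> t)) t"
proof (induction t arbitrary: \<Gamma>)
  case (Pi A B)
  let ?B = "bt (tr (A # \<Gamma>) B)" and ?C = "bt (Epsilon (sort_of P \<Gamma> A) (tr \<Gamma> A))"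
  have "conv {} (bt (tr \<Gamma> (Pi A B))) (Pi (bt (tr \<Gamma> A)) (App (ren Suc (Lam ?C ?B)) (Var 0)))"
    using bt_DotPi[of _ _ _ "tr \<Gamma> A" "Lam (Epsilon (sort_of P \<Gamma> A) (tr \<Gamma> A)) (tr (A # \<Gamma>) B)"]
    by (simp add: transl.simps(3))
  also have "conv {} \<dots> (Pi A B)"
    using conv_beta[of "{}" "ren Suc ?C" "ren (up_ren Suc) ?B" "Var 0"] Pi.IH(2)[of "A # \<Gamma>"]
    by (intro conv_Pi Pi.IH(1)) (simp add: inst_Var_up_ren, blast intro: conv_trans)
  finally show ?case .
next
  case (Lam A t)
  show ?case using conv_Lam[OF conv_trans[OF conv_id Lam.IH(1)[of \<Gamma>]] Lam.IH(2)[of "A # \<Gamma>"]]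
    by (simp add: transl.simps(4))
qed (simp_all add: conv_App)

lemma bt_transl_type: "transl_type P \<Gamma> A = Some T \<Longrightarrow> conv {} (bt T) A"
  by (erule transl_type_cases) (use conv_trans[OF bt_Epsilon bt_transl] in simp_all)

lemma typed_transl_type:
  assumes "PT.wfctx False \<Gamma>" "transl_type P \<Gamma> A = Some T"
  shows "lt (tctx \<Gamma>) T (Atom Type)"
  using assms(2)
proof (cases rule: transl_type_cases)
  case (1 s)
  then show ?thesis using typed_tt[OF 1(1)] by (simp add: tt_typed)
next
  case (2 s)
  then show ?thesis using typed_U wf_tctx[OF assms(1)] by simp
qed

text \<open>The conversion is carried back by \<open>bt\<close>. As \<open>A\<close> may be a sort
  without a type, the plain conversion rule is not enough.\<close>

lemma typed_conv_transl_type: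
  assumes "pt \<Gamma> u B" "conv Rw (tt \<Gamma> B) T" "transl_type P \<Gamma> A = Some T"
  shows "pt \<Gamma> u A"
proof (rule PT.typed_conv_Atom[OF assms(1)])
  obtain T' where "transl_type P \<Gamma> B = Some T'"
    using transl_type_valid[OF PT.typ_valid[OF assms(1)]] by blast
  then have "conv {} (bt (tt \<Gamma> B)) B" using bt_transl_type by simp
  then show "conv {} B A" using bt_conv[OF assms(2)] bt_transl_type[OF assms(3)] conv_sym conv_trans by blast
  show "(\<exists>s\<in>UNIV. pt \<Gamma> A (Atom s)) \<or> (\<exists>a. A = Atom a)"
    using assms(3) by (rule transl_type_cases) auto
qed

text \<open>\<open>C\<close> and \<open>D\<close> are arbitrary, but \<open>bt\<close> makes
  \<open>A\<close> convertible to a product, so \<open>A\<close> reduces to some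
  \<open>Pi A1 A2\<close> by confluence. Subject reduction types it, and product injectivity relates
  its translation to \<open>C\<close> and \<open>D\<close>.\<close>

lemma transl_type_conv_Pi:
  assumes "transl_type P \<Gamma> A = Some T" "conv Rw T (Pi C D)"
  obtains A1 A2 s1 s2 s3 where "pt \<Gamma> A1 (Atom s1)" "pt (A1 # \<Gamma>) A2 (Atom s2)" "(s1, s2, s3) \<in> ruls P"
    "conv {} (Pi A1 A2) A" "pt \<Gamma> A (Atom s3)" "conv Rw C (tt \<Gamma> A1)" "conv Rw D (tt (A1 # \<Gamma>) A2)"
proof -
  have "conv {} A (Pi (bt C) (bt D))"
    using bt_conv[OF assms(2)] bt_transl_type[OF assms(1)] conv_sym conv_trans by fastforce
  then obtain A1 A2 where red: "(red {})\<^sup>*\<^sup>* A (Pi A1 A2)" by (rule conv_PiD[OF PT.orth])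
  \<comment> \<open>A term that reduces to a product is no atom, which excludes untypable sorts and
    leaves a sort for \<open>A\<close>.\<close>
  have "\<nexists>a. A = Atom a" using red reds_Atom[OF PT.orth] by blast
  then obtain s where s: "pt \<Gamma> A (Atom s)" "T = Epsilon s (tr \<Gamma> A)"
    using assms(1) by (auto elim: transl_type_cases)
  have Pi: "pt \<Gamma> (Pi A1 A2) (Atom s)" using PT.subject_reductions[OF red s(1)] .
  then obtain s1 s2 s3 where 1: "pt \<Gamma> A1 (Atom s1)" "pt (A1 # \<Gamma>) A2 (Atom s2)" "(s1, s2, s3) \<in> ruls P"
    "conv {} (Atom s3) (Atom s)" by (rule PT.gen_Pi)
  then have [simp]: "s3 = s" by (simp add: conv_Atom_Atom[OF PT.orth])
  have "conv Rw T (tt \<Gamma> (Pi A1 A2))" using tt_conv[OF s(1) Pi reds_conv[OF red]] s by (simp add: tt_typed)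
  also have "conv Rw \<dots> (Pi (tt \<Gamma> A1) (tt (A1 # \<Gamma>) A2))" by (rule reds_conv[OF reds_tt_Pi[OF 1(1-3)]])
  finally have *: "conv Rw (Pi C D) (Pi (tt \<Gamma> A1) (tt (A1 # \<Gamma>) A2))" using assms(2) conv_sym conv_trans by blast
  show ?thesis
    by (rule that[OF 1(1-3) conv_sym[OF reds_conv[OF red]] _ Pi_injective[OF LT.orth *]]) (simp add: s(1))
qed


subsection \<open>Expansion of product constants\<close>

text \<open>The \<eta>-long form of the constant: both arguments are abstracted, and the second one
  is itself expanded, so that it becomes an abstraction.\<close>

definition eta :: "'s \<Rightarrow> 's \<Rightarrow> 's \<Rightarrow> 's emb_trm" where
  "eta s1 s2 s3 = Lam (U s1) (Lam (Pi (Epsilon s1 (Var 0)) (U s2))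
     (DotPi s1 s2 s3 (Var 1) (Lam (Epsilon s1 (Var 1)) (App (Var 1) (Var 0)))))"

fun ex_atom :: "'s emb_const lp_atom \<Rightarrow> 's emb_trm" where
  "ex_atom (Cst (CDotPi s1 s2 s3)) = eta s1 s2 s3"
| "ex_atom a = Atom a"

abbreviation expand :: "'s emb_trm \<Rightarrow> 's emb_trm" where
  "expand \<equiv> asub ex_atom"

lemma closed_ex_atom: "subst \<sigma> (ex_atom a) = ex_atom a"
  by (cases a rule: ex_atom.cases) (simp_all add: eta_def numeral_2_eq_2)

lemma eta_conv:
  "conv R (App (App (eta s1 s2 s3) X) Y)
     (DotPi s1 s2 s3 X (Lam (Epsilon s1 X) (App (ren Suc Y) (Var 0))))"
proof -
  let ?b = "DotPi s1 s2 s3 (ren Suc X) (Lam (Epsilon s1 (ren Suc X)) (App (Var 1) (Var 0)))"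
  have "conv R (App (eta s1 s2 s3) X) (Lam (Pi (Epsilon s1 X) (U s2)) ?b)"
    using conv_beta[of R "U s1" "Lam (Pi (Epsilon s1 (Var 0)) (U s2))
        (DotPi s1 s2 s3 (Var 1) (Lam (Epsilon s1 (Var 1)) (App (Var 1) (Var 0))))" X]
    by (simp add: eta_def inst_eq)
  then have "conv R (App (App (eta s1 s2 s3) X) Y) (App (Lam (Pi (Epsilon s1 X) (U s2)) ?b) Y)"
    by (simp add: conv_App)
  also have "conv R \<dots> (inst Y ?b)" by (rule conv_beta)
  also have "inst Y ?b = DotPi s1 s2 s3 X (Lam (Epsilon s1 X) (App (ren Suc Y) (Var 0)))"
    using inst_lift[of Y X] by (simp add: inst_eq)
  finally show ?thesis .
qed

text \<open>The second family of rules survives: \<beta>-steps turn the expanded left-hand side into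
  a dotted product with second argument \<lambda>x. Y x, which unfolds to the same product as
  before.\<close>

lemma expand_conv: "conv Rw t u \<Longrightarrow> conv Rw (expand t) (expand u)"
proof (rule asub_conv[OF closed_ex_atom])
  fix l r and \<sigma> :: "nat \<Rightarrow> 's emb_trm" assume lr: "(l, r) \<in> Rw"
  then consider s1 s2 where "l = Epsilon s2 (Dot s1)" "r = U s1"
    | s1 s2 s3 where "l = Epsilon s3 (DotPi s1 s2 s3 (Var 1) (Var 0))"
        "r = Pi (Epsilon s1 (Var 1)) (Epsilon s2 (App (Var 1) (Var 0)))" "(s1, s2, s3) \<in> ruls P"
    by (auto simp: emb_rew_def)
  then have "conv Rw (expand l) (expand r)"
  proof cases
    case 1
    then show ?thesis using red_conv[OF red.rewrite[OF lr, of Var]] by simp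
  next
    case 2
    have "conv Rw (Epsilon s3 (App (App (eta s1 s2 s3) (Var 1)) (Var 0)))
        (Epsilon s3 (DotPi s1 s2 s3 (Var 1) (Lam (Epsilon s1 (Var 1)) (App (ren Suc (Var 0)) (Var 0)))))"
      by (intro conv_App conv_refl eta_conv)
    also have "conv Rw \<dots> (Pi (Epsilon s1 (Var 1)) (Epsilon s2 (App (ren Suc (Var 0)) (Var 0))))"
      by (rule reds_conv[OF reds_Epsilon_DotPi[OF 2(3)]])
    finally show ?thesis by (simp add: 2)
  qed
  then show "conv Rw (subst \<sigma> (expand l)) (subst \<sigma> (expand r))" by (rule conv_subst)
qed

text \<open>In a translation the second argument of a product constant is already an abstraction, so
  the \<eta>-expansion is undone by \<beta>.\<close>

lemma expand_transl: "conv Rw (expand (tr \<Gamma> t)) (tr \<Gamma> t)"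
proof (induction t arbitrary: \<Gamma>)
  case (Pi A B)
  let ?s1 = "sort_of P \<Gamma> A" and ?s2 = "sort_of P (A # \<Gamma>) B" and ?s3 = "sort_of P \<Gamma> (Pi A B)"
  let ?A = "expand (tr \<Gamma> A)" and ?B = "expand (tr (A # \<Gamma>) B)"
  have "conv Rw (expand (tr \<Gamma> (Pi A B)))
      (DotPi ?s1 ?s2 ?s3 ?A (Lam (Epsilon ?s1 ?A) (App (ren Suc (Lam (Epsilon ?s1 ?A) ?B)) (Var 0))))"
    using eta_conv[of Rw ?s1 ?s2 ?s3 ?A "Lam (Epsilon ?s1 ?A) ?B"] by (simp add: transl.simps(3))
  also have "conv Rw \<dots> (DotPi ?s1 ?s2 ?s3 ?A (Lam (Epsilon ?s1 ?A) ?B))"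
    using conv_beta[of Rw "ren Suc (Epsilon ?s1 ?A)" "ren (up_ren Suc) ?B" "Var 0"]
    by (intro conv_App conv_Lam conv_refl) (simp add: inst_Var_up_ren)
  also have "conv Rw \<dots> (tr \<Gamma> (Pi A B))"
    unfolding transl.simps(3) by (intro conv_App conv_Lam conv_refl Pi.IH)
  finally show ?case .
qed (simp_all add: conv_App conv_Lam transl.simps(4))

lemma expand_transl_type: "transl_type P \<Gamma> A = Some T \<Longrightarrow> conv Rw (expand T) T"
  by (erule transl_type_cases) (simp_all add: conv_App expand_transl)

lemma expand_Sg: "(c, A) \<in> emb_Sg \<Longrightarrow> expand A = A"
  by (auto simp: emb_Sg_def emb_sig_def arrow_Atom)

lemma typed_eta:
  assumes wf: "LT.wfctx b \<Gamma>" and r: "(s1, s2, s3) \<in> ruls P"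
  shows "LT.typed b \<Gamma> (eta s1 s2 s3) (DotPi_type s1 s2 s3)"
proof -
  have s: "s1 \<in> srts P" "s2 \<in> srts P" "s3 \<in> srts P" using ruls_srts[OF r] by auto
  have X: "LT.typed b \<Gamma> (U s1) (Atom Type)" using wf s typed_U by blast
  note wf1 = wfctx_Cons[OF X]
  have "LT.typed b (U s1 # \<Gamma>) (Var 0) (U s1)" using LT.typ_var[OF wf1, of 0] by simp
  then have Y: "LT.typed b (U s1 # \<Gamma>) (Pi (Epsilon s1 (Var 0)) (U s2)) (Atom Type)"
    using s by (intro typed_arrow_U typed_Epsilon)
  note wf2 = wfctx_Cons[OF Y]
  let ?\<Delta> = "Pi (Epsilon s1 (Var 0)) (U s2) # U s1 # \<Gamma>"
  have X': "LT.typed b ?\<Delta> (Var 1) (U s1)" using LT.typ_var[OF wf2, of 1] by simp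
  then have x: "LT.typed b ?\<Delta> (Epsilon s1 (Var 1)) (Atom Type)" using s by (intro typed_Epsilon)
  note wf3 = wfctx_Cons[OF x]
  have "LT.typed b (Epsilon s1 (Var 1) # ?\<Delta>) (Var 1) (Pi (Epsilon s1 (Var 2)) (U s2))"
    "LT.typed b (Epsilon s1 (Var 1) # ?\<Delta>) (Var 0) (Epsilon s1 (Var 2))"
    using LT.typ_var[OF wf3, of 1] LT.typ_var[OF wf3, of 0] by (simp_all add: numeral_2_eq_2)
  from LT.typ_app[OF this] have "LT.typed b (Epsilon s1 (Var 1) # ?\<Delta>) (App (Var 1) (Var 0)) (U s2)"
    by (simp add: inst_eq)
  then have "LT.typed b ?\<Delta> (Lam (Epsilon s1 (Var 1)) (App (Var 1) (Var 0))) (Pi (Epsilon s1 (Var 1)) (U s2))"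
    using typed_Lam[OF x typed_U[OF wf3 s(2)]] by simp
  then have "LT.typed b ?\<Delta> (DotPi s1 s2 s3 (Var 1) (Lam (Epsilon s1 (Var 1)) (App (Var 1) (Var 0)))) (U s3)"
    using typed_DotPi[OF X' _ r] by blast
  then show ?thesis
    unfolding eta_def using typed_Lam[OF X typed_arrow_U[OF Y s(3)]] typed_Lam[OF Y typed_U[OF wf2 s(3)]]
    by simp
qed

lemma ty_map: "i < length \<Gamma> \<Longrightarrow> ty (map expand \<Gamma>) i = expand (ty \<Gamma> i)"
  by (simp add: ty_def lift_def asub_ren[OF closed_ex_atom])

text \<open>\<open>eta\<close> has the type of the constant it replaces, the types in the signature
  contain no such constant, and conversions are preserved.\<close>

lemma typed_expand:
  "(LT.wfctx False \<Gamma>0 \<longrightarrow> LT.wfctx False (map expand \<Gamma>0)) \<and>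
   (lt \<Gamma> t T \<longrightarrow> lt (map expand \<Gamma>) (expand t) (expand T))"
proof (rule LT.wfctx_typed.induct, goal_cases)
  case 1
  show ?case by (simp add: LT.wf_empty)
next
  case (2 \<Gamma> A s)
  then show ?case using LT.wf_decl[of False "map expand \<Gamma>" "expand A" s] by auto
next
  case (3 \<Gamma> s1 s2)
  then show ?case by (auto intro: typed_Type)
next
  case (4 \<Gamma> c A s)
  show ?case
  proof (cases "\<exists>s1 s2 s3. c = Cst (CDotPi s1 s2 s3)")
    case True
    then show ?thesis using 4 expand_Sg[OF 4(3)] typed_eta by auto
  next
    case False
    then have "ex_atom c = Atom c" by (cases c rule: ex_atom.cases) auto
    moreover have "lt [] A (Atom s)" using 4 by blast
    ultimately show ?thesis using 4 expand_Sg[OF 4(3)] LT.typ_const[OF 4(2,3)] by simp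
  qed
next
  case (5 \<Gamma> i)
  then show ?case using LT.typ_var[of False "map expand \<Gamma>" i] by (simp add: ty_map)
next
  case (6 \<Gamma> A s1 B s2 s3)
  then show ?case by (auto intro: typed_Pi)
next
  case (7 \<Gamma> A s1 B s2 t s3)
  then show ?case by (auto intro: typed_Lam)
next
  case (8 \<Gamma> t A B u)
  then show ?case using LT.typ_app by (simp add: asub_inst[OF closed_ex_atom])
next
  case (9 \<Gamma> t A B s)
  then have "expand (Atom s) = Atom s" by auto
  then show ?case using 9 LT.typ_conv[OF 9(2) expand_conv[OF 9(3)]] by simp
qed


text \<open>Only the last clause admits a product constant. Since \<open>full_Atom\<close> excludes
  it, neither the constant nor its partial application is \<open>full\<close>.\<close>

inductive full :: "'s emb_trm \<Rightarrow> bool" where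
  full_Var: "full (Var i)"
| full_Atom: "(\<And>s1 s2 s3. a \<noteq> Cst (CDotPi s1 s2 s3)) \<Longrightarrow> full (Atom a)"
| full_Pi: "full A \<Longrightarrow> full B \<Longrightarrow> full (Pi A B)"
| full_Lam: "full A \<Longrightarrow> full t \<Longrightarrow> full (Lam A t)"
| full_App: "full t \<Longrightarrow> full u \<Longrightarrow> full (App t u)"
| full_DotPi: "full X \<Longrightarrow> full C \<Longrightarrow> full Y \<Longrightarrow> full (DotPi s1 s2 s3 X (Lam C Y))"

inductive_cases full_AtomE: "full (Atom a)"
inductive_cases full_LamE: "full (Lam A B)"
inductive_cases full_AppE: "full (App A B)"

lemma full_ren: "full t \<Longrightarrow> full (ren f t)"
  by (induction arbitrary: f rule: full.induct) (auto intro: full.intros)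

lemma full_subst: "full t \<Longrightarrow> (\<And>i. full (\<sigma> i)) \<Longrightarrow> full (subst \<sigma> t)"
proof (induction arbitrary: \<sigma> rule: full.induct)
  have up: "full (up_subst \<sigma> i)" if "\<And>i. full (\<sigma> i)" for \<sigma> i
    using that by (cases i) (auto intro: full_Var full_ren)
  {
    case (full_Pi A B)
    then show ?case using up by (simp add: full.full_Pi)
  next
    case (full_Lam A B)
    then show ?case using up by (simp add: full.full_Lam)
  next
    case (full_DotPi X C Y)
    then show ?case using up by (simp add: full.full_DotPi)
  }
qed (auto intro: full.intros)

lemma full_inst: "full t \<Longrightarrow> full u \<Longrightarrow> full (inst u t)"
  unfolding inst_eq by (rule full_subst) (auto split: nat.split intro: full_Var)

lemma full_rew:
  assumes "(l, r) \<in> Rw" "full (subst \<sigma> l)"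
  shows "full (subst \<sigma> r)"
proof -
  consider s1 s2 where "l = Epsilon s2 (Dot s1)" "r = U s1"
    | s1 s2 s3 where "l = Epsilon s3 (DotPi s1 s2 s3 (Var 1) (Var 0))"
        "r = Pi (Epsilon s1 (Var 1)) (Epsilon s2 (App (Var 1) (Var 0)))"
    using assms(1) by (auto simp: emb_rew_def)
  then show ?thesis
  proof cases
    case 2
    have "full (DotPi s1 s2 s3 (\<sigma> 1) (\<sigma> 0))" using assms(2) by (auto simp: 2 elim: full_AppE)
    \<comment> \<open>\<open>full_App\<close> cannot yield this term, whose head is a partially
      applied product constant; hence \<open>\<sigma> 0\<close> is a full abstraction.\<close>
    then have "full (\<sigma> 1) \<and> full (\<sigma> 0)"
      by (auto elim!: full_AppE full_AtomE intro: full_Lam)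
    then show ?thesis by (auto simp: 2 intro!: full.intros full_ren)
  qed (auto intro: full.intros)
qed

lemma full_red: "full t \<Longrightarrow> red Rw t u \<Longrightarrow> full u"
proof (induction arbitrary: u rule: full.induct)
  case (full_Pi A B)
  then show ?case by (auto elim!: LT.red_Pi intro: full.full_Pi)
next
  case (full_Lam A t)
  then show ?case by (auto elim!: LT.red_Lam intro: full.full_Lam)
next
  case (full_App t v)
  from full_App.prems show ?case
  proof (rule red_AppE)
    fix A b assume "u = inst v b" "t = Lam A b"
    then show ?thesis using full_App by (auto elim: full_LamE intro: full_inst)
  next
    fix l r \<sigma> assume "App t v = subst \<sigma> l" "u = subst \<sigma> r" "(l, r) \<in> Rw"
    then show ?thesis using full_App.hyps full.full_App full_rew by metis
  qed (use full_App in \<open>auto intro: full.full_App\<close>)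
next
  case (full_DotPi X C Y s1 s2 s3)
  \<comment> \<open>Dotted products match no left-hand side, and neither do their partial
    applications, so a step takes place inside \<open>X\<close>, \<open>C\<close> or
    \<open>Y\<close>.\<close>
  have root: "App (App (Atom (Cst (CDotPi s1 s2 s3))) X) v \<noteq> subst \<sigma> l"
    "App (Atom (Cst (CDotPi s1 s2 s3))) v \<noteq> subst \<sigma> l" if "(l, r) \<in> Rw" for l r \<sigma> v
    using that by (auto simp: emb_rew_def)
  from full_DotPi.prems show ?case
  proof (rule red_AppE)
    fix t' assume u: "u = App t' (Lam C Y)" and "red Rw (App (Atom (Cst (CDotPi s1 s2 s3))) X) t'"
    from this(2) show ?thesis
      by (rule red_AppE) (use u full_DotPi root(2) in \<open>auto simp: LT.not_red_Atom intro: full.full_DotPi\<close>)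
  next
    fix v assume u: "u = DotPi s1 s2 s3 X v" and "red Rw (Lam C Y) v"
    from this(2) show ?thesis
      by (rule LT.red_Lam) (use u full_DotPi in \<open>auto intro: full.full_DotPi\<close>)
  qed (use root(1) in auto)
qed (simp_all add: LT.not_red_Var LT.not_red_Atom)

lemma full_reds: "(red Rw)\<^sup>*\<^sup>* t u \<Longrightarrow> full t \<Longrightarrow> full u"
  by (induction rule: rtranclp_induct) (auto intro: full_red)

lemma full_eta: "full (eta s1 s2 s3)"
  unfolding eta_def by (intro full.intros) simp_all

lemma full_expand: "full (expand t)"
proof (induction t)
  case (Atom a)
  show ?case by (cases a rule: ex_atom.cases) (auto intro: full_eta full_Atom)
qed (auto intro: full.intros)


section \<open>Conservativity\<close>

definition normal :: "'s emb_trm \<Rightarrow> bool" where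
  "normal t \<longleftrightarrow> (\<forall>u. \<not> red Rw t u)"

lemma normal_AppD: "normal (App t u) \<Longrightarrow> normal t \<and> normal u \<and> (\<nexists>A b. t = Lam A b)"
  unfolding normal_def by (blast intro: red.intros)

lemma normal_LamD: "normal (Lam A t) \<Longrightarrow> normal A \<and> normal t"
  unfolding normal_def by (blast intro: red.intros)

lemma normal_form_exists:
  assumes "strongly_normalizing Rw t"
  obtains n where "(red Rw)\<^sup>*\<^sup>* t n" "normal n"
proof -
  have "\<exists>n. (red Rw)\<^sup>*\<^sup>* t n \<and> normal n"
    using assms unfolding strongly_normalizing_def
  proof (induction rule: accp.induct)
    case (accI t)
    show ?case
    proof (cases "normal t")
      case False
      then obtain u where "red Rw t u" by (auto simp: normal_def)
      then show ?thesis using accI.IH[of u] by (auto intro: converse_rtranclp_into_rtranclp)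
    qed blast
  qed
  then show ?thesis using that by blast
qed

text \<open>The typable terms in the image of no term of the Pure Type System, at least among the full normal
  terms other than abstractions.\<close>

inductive stray :: "'s emb_trm \<Rightarrow> bool" where
  "stray (Atom Type)"
| "stray (U s)"
| "stray (Atom (Cst (CEpsilon s)))"
| "stray (Epsilon s t)"
| "stray (Pi A B)"

lemma stray_type:
  assumes "stray t" "lt \<Delta> t T"
  shows "(\<exists>k\<in>{Type, Kind}. conv Rw (Atom k) T) \<or>
     (\<exists>s\<in>srts P. t = Atom (Cst (CEpsilon s)) \<and> conv Rw (Pi (U s) (Atom Type)) T)"
  using assms
proof cases
  case 1
  then show ?thesis using LT.gen_Atom[of False \<Delta> Type T] assms(2) by (auto simp: emb_Sg_def)
next
  case (2 s)
  then show ?thesis using LT.gen_Atom[of False \<Delta> "Cst (CU s)" T] assms(2) by auto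
next
  case (3 s)
  then show ?thesis using LT.gen_Atom[of False \<Delta> "Cst (CEpsilon s)" T] assms(2) by auto
next
  case (4 s u)
  then show ?thesis using gen_Epsilon assms(2) by auto
next
  case (5 A B)
  then show ?thesis using LT.gen_Pi[of False \<Delta> A B T] assms(2) by auto
qed

lemma gen_Lam_emb:
  assumes "lt \<Delta> (Lam A t) T"
  obtains B where "lt \<Delta> A (Atom Type)" "lt (A # \<Delta>) t B" "conv Rw (Pi A B) T"
  using assms by (rule LT.gen_Lam) (use that in auto)

lemma not_typed_Kind: "\<not> lt \<Delta> (Atom Kind) T"
  using LT.gen_Atom[of False \<Delta> Kind T] by (auto simp: emb_Sg_def)

lemma conv_Type_Kind:
  assumes "lt \<Delta> T (Atom Type)" "conv Rw T' T"
  shows "\<not> lt \<Delta> T' (Atom Kind)" "T' \<noteq> Atom Kind"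
proof -
  show "\<not> lt \<Delta> T' (Atom Kind)" using LT.conv_sort[OF assms(1) _ conv_sym[OF assms(2)]] by blast
  show "T' \<noteq> Atom Kind"
    using conv_AtomD[OF LT.orth] conv_sym[OF assms(2)] LT.subject_reductions assms(1) not_typed_Kind by blast
qed

text \<open>Up to conversion the type of such a term is \<open>Type\<close>, \<open>Kind\<close> or
  a product into \<open>Type\<close>. Each has type \<open>Kind\<close> or none, whereas translated
  types have type \<open>Type\<close>.\<close>

lemma stray_type_Kind:
  assumes "stray t" "lt \<Delta> t T"
  shows "\<not> lt \<Delta> T (Atom Type)"
proof
  assume T: "lt \<Delta> T (Atom Type)"
  have wf: "LT.wfctx False \<Delta>" using LT.typ_wf[OF assms(2)] .
  note * = conv_Type_Kind[OF T]
  have "lt \<Delta> (Pi (U s) (Atom Type)) (Atom Kind)" if "s \<in> srts P" for s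
    using that wf by (intro typed_Pi typed_U typed_Type wfctx_Cons) auto
  then show False using stray_type[OF assms] *(1) *(2) typed_Type[OF wf] by blast
qed

text \<open>The type is inferred here, so \<open>T\<close> is arbitrary. Structural induction
  follows the head of an application, whose type need not be given as a translation. The hypothesis
  on sizes serves the arguments and the parts of dotted products, whose types are translations,
  possibly in longer contexts.\<close>

lemma conservativity_step:
  assumes IH: "\<And>t' \<Gamma> A T. size t' < size t \<Longrightarrow> PT.wfctx False \<Gamma> \<Longrightarrow> transl_type P \<Gamma> A = Some T \<Longrightarrow>
      lt (tctx \<Gamma>) t' T \<Longrightarrow> full t' \<Longrightarrow> normal t' \<Longrightarrow> \<exists>u. pt \<Gamma> u A \<and> conv Rw (tr \<Gamma> u) t'"
    and wf: "PT.wfctx False \<Gamma>" and t: "lt (tctx \<Gamma>) t T" "full t" "normal t" "\<nexists>A b. t = Lam A b"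
  shows "stray t \<or> (\<exists>u B. pt \<Gamma> u B \<and> conv Rw (tr \<Gamma> u) t \<and> conv Rw (tt \<Gamma> B) T)"
  using IH t
proof (induction t arbitrary: T)
  case (Var i)
  have "i < length \<Gamma>" "conv Rw (tt \<Gamma> (ty \<Gamma> i)) T"
    using LT.gen_Var[OF Var.prems(2)] tctx_ty[OF wf] by auto
  then show ?case using PT.typ_var[OF wf] by (metis transl.simps(1) conv_refl)
next
  case (Atom a)
  show ?case
  proof (cases a)
    case (Cst c)
    show ?thesis
    proof (cases c)
      case (CDot s)
      then obtain s' where s': "(s, s') \<in> axms P" "conv Rw (U s') T"
        using LT.gen_Atom[OF Atom.prems(2)] Cst by auto
      then have "conv Rw (tt \<Gamma> (Atom s')) T" using conv_tt_Atom axms_srts conv_trans by blast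
      then show ?thesis using PT.typ_sort[OF wf s'(1)] Cst CDot by (metis transl.simps(2) conv_refl)
    next
      case (CDotPi s1 s2 s3)
      then show ?thesis using Atom.prems(3) Cst by (auto elim: full_AtomE)
    qed (auto simp: Cst intro: stray.intros)
  next
    case Kind
    then show ?thesis using Atom.prems(2) not_typed_Kind by blast
  qed (auto intro: stray.intros)
next
  case (Pi A B)
  show ?case by (auto intro: stray.intros)
next
  case (Lam A t)
  then show ?case by blast
next
  case (App f a)
  from App.prems(3) show ?case
  proof (rule full_AppE)
    assume full: "full f" "full a"
    obtain C D where 1: "lt (tctx \<Gamma>) f (Pi C D)" "lt (tctx \<Gamma>) a C" "conv Rw (inst a D) T"
      using LT.gen_App[OF App.prems(2)] .
    have "stray f \<or> (\<exists>u B. pt \<Gamma> u B \<and> conv Rw (tr \<Gamma> u) f \<and> conv Rw (tt \<Gamma> B) (Pi C D))"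
    proof (rule App.IH(1))
      show "normal f" "\<nexists>A b. f = Lam A b" using normal_AppD[OF App.prems(4)] by auto
    qed (use App.prems(1) full 1 in simp_all)
    then show ?thesis
    proof
      \<comment> \<open>Neither \<open>Type\<close> nor \<open>Kind\<close> is convertible to a
        product, so the head is \<epsilon> and the application is stray again.\<close>
      assume "stray f"
      with stray_type[OF this 1(1)] have "\<exists>s. f = Atom (Cst (CEpsilon s))"
        using conv_Atom_Pi[OF LT.orth] by auto
      then show ?thesis by (auto intro: stray.intros)
    next
      assume "\<exists>u B. pt \<Gamma> u B \<and> conv Rw (tr \<Gamma> u) f \<and> conv Rw (tt \<Gamma> B) (Pi C D)"
      then obtain u B where u: "pt \<Gamma> u B" "conv Rw (tr \<Gamma> u) f" "conv Rw (tt \<Gamma> B) (Pi C D)" by blast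
      obtain TB where TB: "transl_type P \<Gamma> B = Some TB"
        using transl_type_valid[OF PT.typ_valid[OF u(1)]] by blast
      then have "conv Rw TB (Pi C D)" using u(3) by simp
      then obtain A1 A2 s1 s2 s3 where A: "pt \<Gamma> A1 (Atom s1)" "pt (A1 # \<Gamma>) A2 (Atom s2)"
        "(s1, s2, s3) \<in> ruls P" "conv {} (Pi A1 A2) B" "pt \<Gamma> B (Atom s3)"
        "conv Rw C (tt \<Gamma> A1)" "conv Rw D (tt (A1 # \<Gamma>) A2)"
        by (rule transl_type_conv_Pi[OF TB])
      have u': "pt \<Gamma> u (Pi A1 A2)"
        using PT.typ_conv[OF u(1) conv_sym[OF A(4)] PT.typ_prod[OF A(1-3)]] by simp
      have "lt (tctx \<Gamma>) a (tt \<Gamma> A1)" using LT.typ_conv[OF 1(2) A(6) typed_tt[OF A(1)]] by simp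
      then obtain v where v: "pt \<Gamma> v A1" "conv Rw (tr \<Gamma> v) a"
        using App.prems(1)[of a \<Gamma> A1] wf full normal_AppD[OF App.prems(4)] transl_type_typed[OF A(1)]
        by (auto simp: tt_typed[OF A(1)])
      have "pt \<Gamma> (inst v A2) (Atom s2)" using PT.typ_inst[OF A(2) v(1)] by (simp add: inst_eq)
      then have "tt \<Gamma> (inst v A2) = inst (tr \<Gamma> v) (tt (A1 # \<Gamma>) A2)"
        using transl_inst[OF A(2) v(1)] by (simp add: tt_typed tt_typed[OF A(2)] inst_eq)
      also have "conv Rw \<dots> (inst a D)" by (rule conv_inst[OF v(2) conv_sym[OF A(7)]])
      finally have "conv Rw (tt \<Gamma> (inst v A2)) T" using 1(3) conv_trans by blast
      moreover have "conv Rw (tr \<Gamma> (App u v)) (App f a)" using u(2) v(2) by (simp add: conv_App)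
      ultimately show ?thesis using PT.typ_app[OF u' v(1)] by blast
    qed
  next
    fix X C Y s1 s2 s3
    assume f: "f = App (Atom (Cst (CDotPi s1 s2 s3))) X" and a: "a = Lam C Y"
      and full: "full X" "full C" "full Y"
    note DotPi = gen_DotPi[OF App.prems(2)[unfolded f a]]
    have s: "s1 \<in> srts P" "s2 \<in> srts P" "s3 \<in> srts P" using ruls_srts[OF DotPi(1)] by auto
    have normal: "normal X" "normal Y"
      using App.prems(4) normal_AppD normal_LamD unfolding f a by blast+
    \<comment> \<open>Reading \<open>U s1\<close> as the translated type of the sort
      \<open>s1\<close> makes the size hypothesis applicable.\<close>
    have X: "lt (tctx \<Gamma>) X (tt \<Gamma> (Atom s1))" using DotPi(2) typed_tt_iff[OF s(1)] wf_tctx[OF wf] by simp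
    obtain T1 where "transl_type P \<Gamma> (Atom s1) = Some T1" using transl_type_Atom s(1) by blast
    then obtain V where V: "pt \<Gamma> V (Atom s1)" "conv Rw (tr \<Gamma> V) X"
      using App.prems(1)[of X \<Gamma> "Atom s1" T1] wf X full normal by (auto simp: f)
    obtain E where E: "lt (tctx \<Gamma>) C (Atom Type)" "lt (C # tctx \<Gamma>) Y E"
      "conv Rw (Pi C E) (Pi (Epsilon s1 X) (U s2))"
      using gen_Lam_emb[OF DotPi(3)[unfolded a]] .
    note CE = Pi_injective[OF LT.orth E(3)]
    have V_tt: "tt \<Gamma> V = Epsilon s1 (tr \<Gamma> V)" using tt_typed[OF V(1)] .
    have C: "conv Rw C (tt \<Gamma> V)"
      using conv_trans[OF CE(1) conv_App[OF conv_refl conv_sym[OF V(2)]]] by (simp add: V_tt)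
    \<comment> \<open>The annotation \<open>C\<close> is merely convertible to the translation of
      \<open>V\<close>. Exchanging it turns the context of \<open>Y\<close> into a translated
      one.\<close>
    have "lt (tctx (V # \<Gamma>)) Y E"
      using LT.typ_context_conv[OF E(2) C E(1) typed_tt[OF V(1)]] by simp
    moreover have wf': "PT.wfctx False (V # \<Gamma>)" using PT.wf_decl[OF V(1)] by simp
    ultimately have "lt (tctx (V # \<Gamma>)) Y (U s2)"
      using LT.typ_conv[OF _ CE(2) typed_U[OF wf_tctx[OF wf'] s(2)]] by simp
    then have Y: "lt (tctx (V # \<Gamma>)) Y (tt (V # \<Gamma>) (Atom s2))"
      using typed_tt_iff[OF s(2)] wf_tctx[OF wf'] by simp
    obtain T2 where "transl_type P (V # \<Gamma>) (Atom s2) = Some T2" using transl_type_Atom s(2) by blast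
    then obtain W where W: "pt (V # \<Gamma>) W (Atom s2)" "conv Rw (tr (V # \<Gamma>) W) Y"
      using App.prems(1)[of Y "V # \<Gamma>" "Atom s2" T2] wf' Y full normal by (auto simp: a)
    have "conv Rw (tr \<Gamma> (Pi V W)) (App f a)"
      unfolding transl_Pi[OF V(1) W(1) DotPi(1)] f a
      using conv_sym[OF C] V W by (intro conv_App conv_Lam conv_refl) (simp_all add: V_tt)
    moreover have "conv Rw (tt \<Gamma> (Atom s3)) T" using conv_trans[OF conv_tt_Atom[OF s(3)] DotPi(4)] .
    ultimately show ?thesis using PT.typ_prod[OF V(1) W(1) DotPi(1)] by blast
  qed
qed

text \<open>Abstractions are checked against the given type. Any other normal form has its type
  inferred and then compared with \<open>A\<close> through the inverse translation.\<close>

lemma conservativity: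
  "PT.wfctx False \<Gamma> \<Longrightarrow> transl_type P \<Gamma> A = Some T \<Longrightarrow> lt (tctx \<Gamma>) t T \<Longrightarrow> full t \<Longrightarrow> normal t \<Longrightarrow>
    \<exists>u. pt \<Gamma> u A \<and> conv Rw (tr \<Gamma> u) t"
proof (induction t arbitrary: \<Gamma> A T rule: measure_induct_rule[of size])
  case (less t)
  note wf = less.prems(1) and A = less.prems(2)
  show ?case
  proof (cases "\<exists>C b. t = Lam C b")
    case False
    have "stray t \<or> (\<exists>u B. pt \<Gamma> u B \<and> conv Rw (tr \<Gamma> u) t \<and> conv Rw (tt \<Gamma> B) T)"
      by (rule conservativity_step[OF less.IH wf less.prems(3-5) False])
    moreover have "\<not> stray t" using stray_type_Kind less.prems(3) typed_transl_type[OF wf A] by blast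
    ultimately show ?thesis using typed_conv_transl_type[OF _ _ A] by blast
  next
    case True
    then obtain C b where t: "t = Lam C b" by blast
    obtain E where E: "lt (tctx \<Gamma>) C (Atom Type)" "lt (C # tctx \<Gamma>) b E" "conv Rw (Pi C E) T"
      using gen_Lam_emb[OF less.prems(3)[unfolded t]] .
    \<comment> \<open>The domain in \<open>P\<close> is read off the given type, because the
      annotation \<open>C\<close> need not be a translation.\<close>
    obtain A1 A2 s1 s2 s3 where A': "pt \<Gamma> A1 (Atom s1)" "pt (A1 # \<Gamma>) A2 (Atom s2)"
      "(s1, s2, s3) \<in> ruls P" "conv {} (Pi A1 A2) A" "pt \<Gamma> A (Atom s3)"
      "conv Rw C (tt \<Gamma> A1)" "conv Rw E (tt (A1 # \<Gamma>) A2)"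
      using transl_type_conv_Pi[OF A conv_sym[OF E(3)]] .
    have wf': "PT.wfctx False (A1 # \<Gamma>)" using PT.wf_decl[OF A'(1)] by simp
    have "lt (tctx (A1 # \<Gamma>)) b E"
      using LT.typ_context_conv[OF E(2) A'(6) E(1) typed_tt[OF A'(1)]]
      by (simp add: tt_typed[OF A'(1)])
    then have "lt (tctx (A1 # \<Gamma>)) b (tt (A1 # \<Gamma>) A2)"
      using LT.typ_conv[OF _ A'(7) typed_tt[OF A'(2)]] by simp
    moreover have "full b" "normal b"
      using less.prems(4,5) normal_LamD unfolding t by (blast elim: full_LamE)+
    ultimately obtain u where u: "pt (A1 # \<Gamma>) u A2" "conv Rw (tr (A1 # \<Gamma>) u) b"
      using less.IH[OF _ wf' transl_type_typed[OF A'(2)], of b] by (auto simp: t tt_typed[OF A'(2)])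
    have "pt \<Gamma> (Lam A1 u) A"
      using PT.typ_conv[OF PT.typ_abs[OF A'(1,2) u(1) A'(3)] A'(4,5)] by simp
    moreover have "conv Rw (tr \<Gamma> (Lam A1 u)) t"
      using conv_sym[OF A'(6)] u(2) by (simp add: t transl_Lam[OF A'(1)] tt_typed[OF A'(1)] conv_Lam)
    ultimately show ?thesis by blast
  qed
qed

lemma inhabited_iff:
  assumes "lp_terminating (emb_sig P) Rw" "transl_type P [] A = Some T"
  shows "(\<exists>t. lt [] t T) \<longleftrightarrow> (\<exists>u. pt [] u A)"
proof
  assume "\<exists>t. lt [] t T"
  then obtain t where t: "lt [] t T" ..
  have T: "lt [] T (Atom Type)" using typed_transl_type[OF PT.wf_empty assms(2)] by simp
  have "lt [] (expand t) (expand T)" using typed_expand[of "[]" "[]" t T] t by simp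
  \<comment> \<open>Expansion comes before normalization, and the type may be restored because
    \<open>T\<close> is convertible to its expansion.\<close>
  then have "lt [] (expand t) T" using LT.typ_conv[OF _ expand_transl_type[OF assms(2)] T] by simp
  moreover from this obtain n where n: "(red Rw)\<^sup>*\<^sup>* (expand t) n" "normal n"
    using assms(1) normal_form_exists unfolding lp_terminating_def emb_typ_eq by blast
  ultimately have "lt [] n T" "full n" using LT.subject_reductions full_reds full_expand by blast+
  then show "\<exists>u. pt [] u A" using conservativity[OF PT.wf_empty assms(2), of n] n(2) by auto
next
  assume "\<exists>u. pt [] u A"
  then show "\<exists>t. lt [] t T" using soundness[of "[]"] assms(2) by fastforce
qed

end

theorem theorem1:
  fixes P :: "'s pts" and A :: "'s trm" and T :: "'s emb_trm"
  assumes "is_pts P"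
    and "functional P"
    and "lp_terminating (emb_sig P) (emb_rew P)"
    and "transl_type P [] A = Some T"
  shows "(\<exists>t. emb_typ P [] t T) \<longleftrightarrow> (\<exists>u. pts_typ P [] u A)"
proof -
  interpret embedding P using assms by unfold_locales
  show ?thesis unfolding pts_typ_eq emb_typ_eq using assms(3,4) by (rule inhabited_iff)
qed

end
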